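(* Let $q\ge 2$ be an even integer and let $m\ge 1$. Let $f,g:\{0,1\}^m\to\mathbb{Z}_q$ be two $q$-ary arrays of size $\mathbf{2}^{(m)}$ such that $(f,g)$ is a Golay complementary array pair. Then $(f,g)$ is standard, i.e., there exist a permutation $\pi$ of $\{1,2,\dots,m\}$ and constants $c',c_0,c_1,\dots,c_m\in\mathbb{Z}_q$ such that for all $(x_1,\dots,x_m)\in\{0,1\}^m$, with equalities in $\mathbb{Z}_q$, $$f(x_1,\dots,x_m)=\frac{q}{2}\sum_{k=1}^{m-1}x_{\pi(k)}x_{\pi(k+1)}+\sum_{k=1}^{m}c_kx_k+c_0,$$ $$g(x_1,\dots,x_m)=f(x_1,\dots,x_m)+\frac{q}{2}x_{\pi(1)}+c'.$$
   Context: A $q$-ary array of size $\mathbf{2}^{(m)}$ (i.e. of size $2\times 2\times\cdots\times 2$, dimension $m$) is a function $f:\{0,1\}^m\to\mathbb{Z}_q$. Let $\zeta=e^{2\pi\sqrt{-1}/q}$. The aperiodic auto-correlation of $f$ at shift $\boldsymbol{\tau}=(\tau_1,\dots,\tau_m)\in\{-1,0,1\}^m$ is $$C_f(\boldsymbol{\tau})=\sum_{\mathbf{x}\in\{0,1\}^m}\zeta^{f(\mathbf{x}+\boldsymbol{\tau})-f(\mathbf{x})},$$ where $\mathbf{x}+\boldsymbol{\tau}$ is element-wise addition of integers and a summand is taken to be $0$ whenever $\mathbf{x}+\boldsymbol{\tau}\notin\{0,1\}^m$. A pair $(f_1,f_2)$ of $q$-ary arrays of size $\mathbf{2}^{(m)}$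 is a Golay complementary array pair (GAP) if $C_{f_1}(\boldsymbol{\tau})+C_{f_2}(\boldsymbol{\tau})=0$ for all $\boldsymbol{\tau}\neq\mathbf{0}$. *)

theory Defs
  imports Complex_Main "HOL-Library.FuncSet" "HOL-Combinatorics.Permutations"
    "HOL-Number_Theory.Cong"
begin

text \<open>
  Points and shifts of the $m$-dimensional cube are extensional functions on the index set
  \<open>{1..m}\<close>, with integer entries so that they can be added as integer vectors. The ring of
  integers modulo \<open>q\<close> is represented by its canonical residues \<open>{0..<q}\<close>, and equality in
  it by congruence modulo \<open>q\<close>.
\<close>

definition cube :: "nat \<Rightarrow> (nat \<Rightarrow> int) set" where
  "cube m = {1..m} \<rightarrow>\<^sub>E {0, 1}"

definition shifts :: "nat \<Rightarrow> (nat \<Rightarrow> int) set" where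
  "shifts m = {1..m} \<rightarrow>\<^sub>E {-1, 0, 1}"

definition zero_vec :: "nat \<Rightarrow> nat \<Rightarrow> int" where
  "zero_vec m = (\<lambda>k\<in>{1..m}. 0)"

definition add_vec :: "nat \<Rightarrow> (nat \<Rightarrow> int) \<Rightarrow> (nat \<Rightarrow> int) \<Rightarrow> nat \<Rightarrow> int" where
  "add_vec m x t = (\<lambda>k\<in>{1..m}. x k + t k)"

definition residues_mod :: "int \<Rightarrow> int set" where
  "residues_mod q = {0..<q}"

definition qary_array :: "int \<Rightarrow> nat \<Rightarrow> ((nat \<Rightarrow> int) \<Rightarrow> int) \<Rightarrow> bool" where
  "qary_array q m f \<longleftrightarrow> f \<in> cube m \<rightarrow> residues_mod q"

definition zeta :: "int \<Rightarrow> complex" where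
  "zeta q = exp (2 * of_real pi * \<i> / of_int q)"

definition autocorrelation ::
    "int \<Rightarrow> nat \<Rightarrow> ((nat \<Rightarrow> int) \<Rightarrow> int) \<Rightarrow> (nat \<Rightarrow> int) \<Rightarrow> complex" where
  "autocorrelation q m f t =
     (\<Sum>x\<in>cube m. if add_vec m x t \<in> cube m
                   then zeta q powi (f (add_vec m x t) - f x) else 0)"

definition golay_array_pair ::
    "int \<Rightarrow> nat \<Rightarrow> ((nat \<Rightarrow> int) \<Rightarrow> int) \<Rightarrow> ((nat \<Rightarrow> int) \<Rightarrow> int) \<Rightarrow> bool" where
  "golay_array_pair q m f g \<longleftrightarrow>
     qary_array q m f \<and> qary_array q m g \<and>
     (\<forall>t\<in>shifts m. t \<noteq> zero_vec m \<longrightarrow>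
        autocorrelation q m f t + autocorrelation q m g t = 0)"

definition standard_pair ::
    "int \<Rightarrow> nat \<Rightarrow> ((nat \<Rightarrow> int) \<Rightarrow> int) \<Rightarrow> ((nat \<Rightarrow> int) \<Rightarrow> int) \<Rightarrow> bool" where
  "standard_pair q m f g \<longleftrightarrow>
     (\<exists>p c c0 c'. p permutes {1..m} \<and>
        (\<forall>k\<in>{1..m}. c k \<in> residues_mod q) \<and> c0 \<in> residues_mod q \<and> c' \<in> residues_mod q \<and>
        (\<forall>x\<in>cube m.
           [f x = (q div 2) * (\<Sum>k = 1..m - 1. x (p k) * x (p (k + 1)))
                  + (\<Sum>k = 1..m. c k * x k) + c0] (mod q) \<and>
           [g x = f x + (q div 2) * x (p 1) + c'] (mod q)))"

end

theory Submission
  imports Defs "HOL-Computational_Algebra.Polynomial"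
begin

text \<open>
  Arrays are encoded as unimodular functions on the subsets of an index set \<open>V\<close>, so that the pair
  becomes two multilinear polynomials \<open>A, B\<close> with \<open>A A* + B B* = c \<Prod>z\<^sub>i\<close>, where \<open>*\<close> is
  conjugate reversal. Singling out a variable \<open>m\<close> and writing \<open>A = A\<^sub>0 + z\<^sub>m A\<^sub>1\<close>,
  \<open>B = B\<^sub>0 + z\<^sub>m B\<^sub>1\<close> gives \<open>A\<^sub>0 A\<^sub>1* = - B\<^sub>0 B\<^sub>1*\<close>. All factors have degree one in each other
  variable \<open>i\<close>, so \<open>A\<^sub>0 / B\<^sub>0\<close> or \<open>A\<^sub>0 / B\<^sub>1*\<close> does not depend on \<open>z\<^sub>i\<close>; this splits the remaining
  variables into disjoint sets \<open>S\<close> and \<open>T\<close> with \<open>A\<^sub>0 = D(z\<^sub>S) P(z\<^sub>T)\<close>, \<open>B\<^sub>0 = D Q\<close>, \<open>B\<^sub>1* = E P\<close> and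
  \<open>A\<^sub>1* = - E Q\<close>. The \<open>z\<^sub>m\<close>-coefficient of the identity then reads
  \<open>(D D* + E E*) (P P* + Q Q*) = c \<Prod>z\<^sub>i\<close>, so \<open>(D, E)\<close> and \<open>(P, Q)\<close> are again complementary pairs,
  on \<open>S\<close> and \<open>T\<close>. By induction they come from paths, and \<open>m\<close> joins the path on \<open>T\<close> to the reversed path
  on \<open>S\<close>.
\<close>

section \<open>Polynomial functions on lines and ratios independent of a variable\<close>

text \<open>
  Polynomiality along every complex line is all that is needed to exclude zero divisors, so no
  multivariate polynomials are required.
\<close>
definition polyline :: "(('i \<Rightarrow> complex) \<Rightarrow> complex) \<Rightarrow> bool" where
  "polyline F \<longleftrightarrow> (\<forall>u v. \<exists>p. \<forall>t. F (\<lambda>k. u k + t * (v k - u k)) = poly p t)"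

lemma polyline_const [intro]: "polyline (\<lambda>z. c)"
  unfolding polyline_def by (intro allI exI[of _ "[:c:]"]) simp

lemma polyline_coord [intro]: "polyline (\<lambda>z. z i)"
  unfolding polyline_def
proof (intro allI)
  fix u v :: "'a \<Rightarrow> complex"
  show "\<exists>p. \<forall>t. u i + t * (v i - u i) = poly p t"
    by (intro exI[of _ "[:u i, v i - u i:]"]) simp
qed

lemma polyline_add [intro]: "polyline F \<Longrightarrow> polyline G \<Longrightarrow> polyline (\<lambda>z. F z + G z)"
  unfolding polyline_def by (metis poly_add)

lemma polyline_diff [intro]: "polyline F \<Longrightarrow> polyline G \<Longrightarrow> polyline (\<lambda>z. F z - G z)"
  unfolding polyline_def by (metis poly_diff)

lemma polyline_mult [intro]: "polyline F \<Longrightarrow> polyline G \<Longrightarrow> polyline (\<lambda>z. F z * G z)"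
  unfolding polyline_def by (metis poly_mult)

lemma polyline_sum [intro]: "(\<And>x. x \<in> A \<Longrightarrow> polyline (F x)) \<Longrightarrow> polyline (\<lambda>z. \<Sum>x\<in>A. F x z)"
  by (induction A rule: infinite_finite_induct) auto

lemma polyline_prod [intro]: "(\<And>x. x \<in> A \<Longrightarrow> polyline (F x)) \<Longrightarrow> polyline (\<lambda>z. \<Prod>x\<in>A. F x z)"
  by (induction A rule: infinite_finite_induct) auto

lemma polyline_upd [intro]: "polyline F \<Longrightarrow> polyline (\<lambda>z. F (z(i := c)))"
  unfolding polyline_def
proof (intro allI)
  fix u v :: "'a \<Rightarrow> complex"
  assume *: "\<forall>u v. \<exists>p. \<forall>t. F (\<lambda>k. u k + t * (v k - u k)) = poly p t"
  obtain p where p: "\<forall>t. F (\<lambda>k. (u(i := c)) k + t * ((v(i := c)) k - (u(i := c)) k)) = poly p t"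
    using * by blast
  have "(\<lambda>k. u k + t * (v k - u k))(i := c) = (\<lambda>k. (u(i := c)) k + t * ((v(i := c)) k - (u(i := c)) k))" for t
    by auto
  then show "\<exists>p. \<forall>t. F ((\<lambda>k. u k + t * (v k - u k))(i := c)) = poly p t"
    using p by metis
qed

text \<open>Restricted to the line from \<open>z\<close> to \<open>v\<close>, both factors are
  univariate polynomials. The one of \<open>F\<close> is nonzero because of its value at
  \<open>t = 1\<close>, so the one of \<open>G\<close> is the zero polynomial, and
  \<open>t = 0\<close> gives the value at \<open>z\<close>.\<close>

lemma polyline_mult_eq_0:
  assumes "polyline F" "polyline G" "\<And>z. F z * G z = 0" "F v \<noteq> 0"
  shows "G z = 0"
proof -
  let ?l = "\<lambda>t k. z k + t * (v k - z k)"
  obtain p where p: "\<And>t. F (?l t) = poly p t" using assms(1) unfolding polyline_def by metis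
  obtain q where q: "\<And>t. G (?l t) = poly q t" using assms(2) unfolding polyline_def by metis
  have "poly p 1 \<noteq> 0" using p[of 1] assms(4) by simp
  moreover have "poly (p * q) t = 0" for t using assms(3)[of "?l t"] p q by simp
  then have "p * q = 0" using poly_all_0_iff_0 by blast
  ultimately have "q = 0" by auto
  with q[of 0] show ?thesis by simp
qed

lemma polyline_cancel:
  assumes "polyline F" "polyline G" "polyline H" "\<And>z. F z * G z = F z * H z" "F v \<noteq> 0"
  shows "G z = H z"
  using polyline_mult_eq_0[of F "\<lambda>z. G z - H z" v z] assms by (auto simp: algebra_simps)

section \<open>Quotients that do not depend on a variable\<close>

definition affine_in :: "'i \<Rightarrow> (('i \<Rightarrow> complex) \<Rightarrow> complex) \<Rightarrow> bool" where
  "affine_in i F \<longleftrightarrow> (\<forall>z w. F (z(i := w)) = (1 - w) * F (z(i := 0)) + w * F (z(i := 1)))"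

text \<open>For functions affine in \<open>z i\<close> this says that the quotient \<open>A / B\<close> does not depend on \<open>z i\<close>.\<close>
definition ratio_indep :: "'i \<Rightarrow> (('i \<Rightarrow> complex) \<Rightarrow> complex) \<Rightarrow> (('i \<Rightarrow> complex) \<Rightarrow> complex) \<Rightarrow> bool" where
  "ratio_indep i A B \<longleftrightarrow> (\<forall>z. A (z(i := 0)) * B (z(i := 1)) = A (z(i := 1)) * B (z(i := 0)))"

text \<open>By interpolation in \<open>z i\<close>, the difference of the two sides is
  \<open>w - v\<close> times the same difference for the values 0 and 1.\<close>

lemma ratio_indep_upd:
  assumes "affine_in i A" "affine_in i B" "ratio_indep i A B"
  shows "A (z(i := v)) * B (z(i := w)) = A (z(i := w)) * B (z(i := v))"
proof -
  define a0 a1 b0 b1 where ab: "a0 = A (z(i := 0))" "a1 = A (z(i := 1))"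
    "b0 = B (z(i := 0))" "b1 = B (z(i := 1))"
  have h: "a0 * b1 = a1 * b0" using assms(3) unfolding ratio_indep_def ab by blast
  have "A (z(i := w)) = (1 - w) * a0 + w * a1" "B (z(i := w)) = (1 - w) * b0 + w * b1" for w
    using assms(1,2) unfolding affine_in_def ab by blast+
  note ab' = this
  show ?thesis unfolding ab'[of v] ab'[of w] using h by algebra
qed

text \<open>The coordinates in \<open>U\<close> are changed one at a time. Chaining two such
  identities through an intermediate point needs a division by the value of \<open>B\<close> there,
  which may be zero; hence all points are moved towards \<open>v\<close> along lines and the
  division takes place among univariate polynomials.\<close>

lemma ratio_indep_set:
  assumes "finite U" "polyline A" "polyline B" "B v \<noteq> 0"
    and "\<And>i. i \<in> U \<Longrightarrow> affine_in i A" "\<And>i. i \<in> U \<Longrightarrow> affine_in i B"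
    and "\<And>i. i \<in> U \<Longrightarrow> ratio_indep i A B"
    and "\<And>k. k \<notin> U \<Longrightarrow> z k = z' k"
  shows "A z * B z' = A z' * B z"
  using assms(1,5-8)
proof (induction U arbitrary: z z' rule: finite_induct)
  case empty
  then have "z = z'" by auto
  then show ?case by simp
next
  case (insert i U)
  \<comment> \<open>The intermediate point agrees with \<open>z\<close> outside \<open>U\<close> and
    with \<open>z'\<close> outside \<open>{i}\<close>.\<close>
  let ?z'' = "z'(i := z i)"
  let ?l = "\<lambda>z t k. z k + t * (v k - z k)"
  have key: "B (?l ?z'' t) * (A (?l z t) * B (?l z' t) - A (?l z' t) * B (?l z t)) = 0" for t
  proof -
    have 1: "A (?l z t) * B (?l ?z'' t) = A (?l ?z'' t) * B (?l z t)"
      by (rule insert.IH) (use insert.prems in auto)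
    have e: "?l ?z'' t = (?l z' t)(i := ?l z t i)" by auto
    have e': "(?l z' t)(i := ?l z' t i) = ?l z' t" by auto
    have 2: "A (?l ?z'' t) * B (?l z' t) = A (?l z' t) * B (?l ?z'' t)"
      using ratio_indep_upd[of i A B "?l z' t" "?l z t i" "?l z' t i"] insert.prems(1-3)[of i]
      unfolding e e' by blast
    show ?thesis using 1 2 by algebra
  qed
  obtain p where p: "\<And>t. B (?l ?z'' t) = poly p t" using assms(3) unfolding polyline_def by blast
  obtain q where q: "\<And>t. A (?l z t) = poly q t" using assms(2) unfolding polyline_def by blast
  obtain q' where q': "\<And>t. A (?l z' t) = poly q' t" using assms(2) unfolding polyline_def by blast
  obtain r where r: "\<And>t. B (?l z t) = poly r t" using assms(3) unfolding polyline_def by blast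
  obtain r' where r': "\<And>t. B (?l z' t) = poly r' t" using assms(3) unfolding polyline_def by blast
  have "poly p 1 \<noteq> 0" using p[of 1] assms(4) by simp
  moreover have "poly (p * (q * r' - q' * r)) t = 0" for t
    using key[of t] unfolding p q q' r r' by simp
  then have "p * (q * r' - q' * r) = 0" using poly_all_0_iff_0 by blast
  ultimately have "q * r' - q' * r = 0" by auto
  then have "poly q 0 * poly r' 0 = poly q' 0 * poly r 0"
    by (metis eq_iff_diff_eq_0 poly_mult)
  then show ?case using q[of 0] q'[of 0] r[of 0] r'[of 0] by simp
qed

text \<open>The root of the first factor on the left, possibly at infinity, is a root of a factor on
  the right, and the two determinants detect this. The points \<open>0\<close>, \<open>1\<close> and
  \<open>-1\<close> give all three coefficients of the quadratic identity.\<close>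

lemma affine_product_zero:
  fixes a0 a1 b0 b1 c0 c1 e0 e1 :: complex
  assumes "\<And>w. ((1 - w) * a0 + w * a1) * ((1 - w) * c0 + w * c1)
             = - (((1 - w) * b0 + w * b1) * ((1 - w) * e0 + w * e1))"
  shows "(a0 * b1 - a1 * b0) * (a0 * e1 - a1 * e0) = 0"
proof -
  have 0: "a0 * c0 = - (b0 * e0)" using assms[of 0] by simp
  have 1: "a1 * c1 = - (b1 * e1)" using assms[of 1] by simp
  have "(2 * a0 - a1) * (2 * c0 - c1) = - ((2 * b0 - b1) * (2 * e0 - e1))"
    using assms[of "-1"] by simp
  with 0 1 have "a0 * c1 + a1 * c0 = - (b0 * e1 + b1 * e0)" by algebra
  with 0 1 show ?thesis by algebra
qed

text \<open>If both alternatives failed, the two cross differences would be nonzero polynomial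
  functions, while \<open>affine_product_zero\<close> makes their product vanish everywhere.\<close>

lemma ratio_indep_cases:
  assumes pl: "polyline A" "polyline B" "polyline E"
    and aff: "affine_in i A" "affine_in i B" "affine_in i C" "affine_in i E"
    and eq: "\<And>z. A z * C z = - (B z * E z)"
  shows "ratio_indep i A B \<or> ratio_indep i A E"
proof (rule ccontr)
  let ?N = "\<lambda>B z. A (z(i := 0)) * B (z(i := 1)) - A (z(i := 1)) * B (z(i := 0))"
  assume "\<not> ?thesis"
  then obtain v w where vw: "?N B v \<noteq> 0" "?N E w \<noteq> 0" unfolding ratio_indep_def by auto
  have "?N B z * ?N E z = 0" for z
    using affine_product_zero[of "A (z(i := 0))" "A (z(i := 1))" "C (z(i := 0))" "C (z(i := 1))"
        "B (z(i := 0))" "B (z(i := 1))" "E (z(i := 0))" "E (z(i := 1))"] aff eq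
    unfolding affine_in_def by metis
  moreover have "polyline (?N B)" "polyline (?N E)"
    by (intro polyline_diff polyline_mult polyline_upd pl)+
  ultimately show False using polyline_mult_eq_0[of "?N B" "?N E" v w] vw by blast
qed

text \<open>The first index is the value of \<open>z i\<close>, the second that of
  \<open>z j\<close>; the assumption makes the quotient of \<open>a\<close> by \<open>b\<close>
  independent of \<open>z i\<close>. If \<open>a00 * a11 - a01 * a10\<close> is nonzero, the linear
  polynomials \<open>a(0, w)\<close> and \<open>a(1, w)\<close> share no root, so \<open>b\<close>
  is a constant multiple of \<open>a\<close> and the quotient does not depend on \<open>z j\<close>
  either.\<close>

lemma affine_cross_zero:
  fixes a00 a01 a10 a11 :: complex
  assumes "\<And>w. ((1 - w) * a00 + w * a01) * ((1 - w) * b10 + w * b11)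
             = ((1 - w) * a10 + w * a11) * ((1 - w) * b00 + w * b01)"
  shows "(a00 * a11 - a01 * a10) *
     (((1 - u) * a00 + u * a10) * ((1 - u) * b01 + u * b11)
        - ((1 - u) * a01 + u * a11) * ((1 - u) * b00 + u * b10)) = 0"
proof -
  let ?D = "a00 * a11 - a01 * a10"
  have 0: "a00 * b10 = a10 * b00" using assms[of 0] by simp
  have 1: "a01 * b11 = a11 * b01" using assms[of 1] by simp
  have "(2 * a00 - a01) * (2 * b10 - b11) = (2 * a10 - a11) * (2 * b00 - b01)"
    using assms[of "-1"] by simp
  with 0 1 have c: "a00 * b11 + a01 * b10 = a10 * b01 + a11 * b00" by algebra
  have d0: "?D * (a00 * b01 - a01 * b00) = 0" using 0 1 c by algebra
  have d1: "?D * (a10 * b11 - a11 * b10) = 0" using 0 1 c by algebra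
  have d2: "?D * (a00 * b11 - a11 * b00 + a10 * b01 - a01 * b10) = 0" using 0 1 c by algebra
  \<comment> \<open>The second factor is a quadratic form in \<open>1 - u\<close> and
    \<open>u\<close>, whose coefficients are annihilated by \<open>?D\<close> one by one.\<close>
  have "((1 - u) * a00 + u * a10) * ((1 - u) * b01 + u * b11)
        - ((1 - u) * a01 + u * a11) * ((1 - u) * b00 + u * b10)
      = (1 - u)^2 * (a00 * b01 - a01 * b00) + u^2 * (a10 * b11 - a11 * b10)
        + u * (1 - u) * (a00 * b11 - a11 * b00 + a10 * b01 - a01 * b10)"
    by (simp add: algebra_simps power2_eq_square)
  then show ?thesis using d0 d1 d2 by algebra
qed

text \<open>Variables \<open>i\<close> and \<open>j\<close> of different kinds separate in
  \<open>A\<close>: the determinant \<open>?D\<close> of the four values of \<open>A\<close>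
  vanishes, because its product with \<open>?N\<close> does and \<open>?N\<close> is not the zero
  function.\<close>

lemma ratio_indep_split:
  assumes pl: "polyline A" "polyline B" and "i \<noteq> j"
    and aff: "affine_in i A" "affine_in i B" "affine_in j A" "affine_in j B"
    and i: "ratio_indep i A B" and j: "\<not> ratio_indep j A B"
  shows "ratio_indep j (\<lambda>z. A (z(i := 0))) (\<lambda>z. A (z(i := 1)))"
proof -
  let ?N = "\<lambda>z. A (z(j := 0)) * B (z(j := 1)) - A (z(j := 1)) * B (z(j := 0))"
  let ?D = "\<lambda>z. A (z(j := 0, i := 0)) * A (z(j := 1, i := 1)) - A (z(j := 1, i := 0)) * A (z(j := 0, i := 1))"
  obtain v where v: "?N v \<noteq> 0" using j unfolding ratio_indep_def by auto
  have "?N z * ?D z = 0" for z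
  proof -
    let ?a = "\<lambda>u w. A (z(j := w, i := u))" and ?b = "\<lambda>u w. B (z(j := w, i := u))"
    have jj: "?a u w = (1 - w) * ?a u 0 + w * ?a u 1" "?b u w = (1 - w) * ?b u 0 + w * ?b u 1" for u w
      using aff(3,4) \<open>i \<noteq> j\<close> unfolding affine_in_def by (metis fun_upd_twist)+
    have ii: "A (z(j := w)) = (1 - z i) * ?a 0 w + z i * ?a 1 w"
      "B (z(j := w)) = (1 - z i) * ?b 0 w + z i * ?b 1 w" for w
      using aff(1,2) \<open>i \<noteq> j\<close> unfolding affine_in_def by (metis fun_upd_triv fun_upd_twist)+
    have "?D z * ?N z = 0"
      unfolding ii
    proof (rule affine_cross_zero)
      fix w
      show "((1 - w) * ?a 0 0 + w * ?a 0 1) * ((1 - w) * ?b 1 0 + w * ?b 1 1)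
             = ((1 - w) * ?a 1 0 + w * ?a 1 1) * ((1 - w) * ?b 0 0 + w * ?b 0 1)"
        using i unfolding jj[symmetric] ratio_indep_def by blast
    qed
    then show ?thesis by (simp add: mult.commute)
  qed
  moreover have "polyline ?N" "polyline ?D"
    by (intro polyline_diff polyline_mult polyline_upd[OF polyline_upd] polyline_upd pl)+
  ultimately have "?D z = 0" for z
    using v polyline_mult_eq_0[of ?N ?D v] by blast
  then show ?thesis unfolding ratio_indep_def by simp
qed

section \<open>Multilinear polynomials\<close>

text \<open>A subset \<open>X\<close> stands for the point of the cube with support
  \<open>X\<close>, so \<open>a\<close> is at once an array and the coefficient family of its
  generating polynomial.\<close>

definition mlin :: "'i set \<Rightarrow> ('i set \<Rightarrow> complex) \<Rightarrow> ('i \<Rightarrow> complex) \<Rightarrow> complex" where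
  "mlin V a z = (\<Sum>X\<in>Pow V. a X * (\<Prod>i\<in>X. z i))"

text \<open>For nonzero coordinates, \<open>mlin V (crev V a) z\<close> is the product of the
  \<open>z i\<close> over \<open>V\<close> times the conjugate of \<open>mlin V a\<close> at the
  point with coordinates \<open>1 / cnj (z i)\<close>.\<close>

definition crev :: "'i set \<Rightarrow> ('i set \<Rightarrow> complex) \<Rightarrow> 'i set \<Rightarrow> complex" where
  "crev V a X = cnj (a (V - X))"

lemma polyline_mlin [intro]: "polyline (mlin V a)"
  unfolding mlin_def by (intro polyline_sum polyline_mult polyline_const polyline_prod polyline_coord)

lemma mlin_empty [simp]: "mlin {} a z = a {}"
  by (simp add: mlin_def)

lemma mlin_insert:
  assumes "finite W" "m \<notin> W"
  shows "mlin (insert m W) a z = mlin W a z + z m * mlin W (\<lambda>X. a (insert m X)) z"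
proof -
  have "(\<Sum>X\<in>insert m ` Pow W. a X * (\<Prod>i\<in>X. z i))
      = (\<Sum>X\<in>Pow W. a (insert m X) * (\<Prod>i\<in>insert m X. z i))"
    using assms(2) by (subst sum.reindex) (auto simp: inj_on_def)
  also have "\<dots> = (\<Sum>X\<in>Pow W. z m * (a (insert m X) * (\<Prod>i\<in>X. z i)))"
  proof (rule sum.cong[OF refl])
    fix X assume "X \<in> Pow W"
    then have "finite X" "m \<notin> X" using assms finite_subset by auto
    then show "a (insert m X) * (\<Prod>i\<in>insert m X. z i) = z m * (a (insert m X) * (\<Prod>i\<in>X. z i))"
      by simp
  qed
  finally show ?thesis
    unfolding mlin_def Pow_insert using assms
    by (subst sum.union_disjoint) (auto simp: sum_distrib_left)
qed

lemma mlin_cong: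
  assumes "\<And>X. X \<subseteq> V \<Longrightarrow> a X = b X" "\<And>i. i \<in> V \<Longrightarrow> z i = z' i"
  shows "mlin V a z = mlin V b z'"
  unfolding mlin_def using assms by (auto intro!: sum.cong prod.cong arg_cong2[where f = "(*)"])

lemma mlin_zero:
  assumes "finite U" "finite S" "U \<inter> S = {}" "\<And>i. i \<in> U \<Longrightarrow> z i = 0"
  shows "mlin (U \<union> S) a z = mlin S a z"
  using assms(1,3,4)
proof (induction U rule: finite_induct)
  case empty
  then show ?case by simp
next
  case (insert i U)
  then have "mlin (insert i (U \<union> S)) a z = mlin (U \<union> S) a z"
    using assms(2) by (subst mlin_insert) auto
  then show ?case using insert by auto
qed

lemma affine_in_mlin: "finite V \<Longrightarrow> affine_in i (mlin V a)"
proof (cases "i \<in> V")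
  case True
  assume "finite V"
  then have fin: "finite (V - {i})" by simp
  have V: "mlin V = mlin (insert i (V - {i}))" using True by (simp add: insert_absorb)
  have upd: "mlin (V - {i}) b (z(i := w)) = mlin (V - {i}) b z" for b z w
    by (rule mlin_cong) auto
  show ?thesis
    unfolding affine_in_def
    unfolding V by (simp add: mlin_insert[OF fin] upd algebra_simps del: insert_Diff_single)
next
  case False
  have "mlin V a (z(i := w)) = mlin V a z" for z w
    by (rule mlin_cong) (use False in auto)
  then show ?thesis unfolding affine_in_def by (simp add: algebra_simps)
qed

lemma mlin_at_0: "finite V \<Longrightarrow> mlin V a (\<lambda>i. 0) = a {}"
  using mlin_zero[of V "{}" "\<lambda>i. 0" a] by simp

text \<open>Both sides are affine in \<open>z m\<close>; the values 0 and 1 of this variable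
  separate the coefficients without \<open>m\<close> from those with \<open>m\<close>.\<close>

lemma mlin_eqD:
  assumes "finite V" "\<And>z. mlin V a z = mlin V b z" "X \<subseteq> V"
  shows "a X = b X"
  using assms
proof (induction V arbitrary: a b X rule: finite_induct)
  case empty
  then show ?case by simp
next
  case (insert m W)
  let ?a = "\<lambda>X. a (insert m X)" and ?b = "\<lambda>X. b (insert m X)"
  have eq: "mlin W a z + w * mlin W ?a z = mlin W b z + w * mlin W ?b z" for z w
  proof -
    have "mlin W c (z(m := w)) = mlin W c z" for c
      by (rule mlin_cong) (use insert.hyps in auto)
    with insert.prems(1)[of "z(m := w)"] show ?thesis
      unfolding mlin_insert[OF insert.hyps(1,2)] by (simp del: fun_upd_apply add: fun_upd_same)
  qed
  have 0: "mlin W a z = mlin W b z" and 1: "mlin W ?a z = mlin W ?b z" for z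
    using eq[of z 0] eq[of z 1] by auto
  show ?case
  proof (cases "m \<in> X")
    case True
    then have "X - {m} \<subseteq> W" "insert m (X - {m}) = X" using insert.prems by auto
    with insert.IH[OF 1, of "X - {m}"] show ?thesis by simp
  next
    case False
    with insert.IH[OF 0, of X] insert.prems show ?thesis by auto
  qed
qed

lemma mlin_mult:
  assumes "finite S" "finite T" "S \<inter> T = {}"
  shows "mlin S d z * mlin T p z = mlin (S \<union> T) (\<lambda>X. d (X \<inter> S) * p (X \<inter> T)) z"
  using assms(2,3)
proof (induction T arbitrary: p rule: finite_induct)
  case empty
  show ?case unfolding mlin_def by (auto simp: sum_distrib_right Int_absorb2 intro!: sum.cong)
next
  case (insert t T)
  let ?f = "\<lambda>X. d (X \<inter> S) * p (X \<inter> insert t T)"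
  have "mlin (insert t (S \<union> T)) ?f z
      = mlin (S \<union> T) ?f z + z t * mlin (S \<union> T) (\<lambda>X. ?f (insert t X)) z"
    using insert assms(1) by (intro mlin_insert) auto
  moreover have "mlin (S \<union> T) ?f z = mlin (S \<union> T) (\<lambda>X. d (X \<inter> S) * p (X \<inter> T)) z"
  proof (rule mlin_cong)
    fix X assume "X \<subseteq> S \<union> T"
    then have "X \<inter> insert t T = X \<inter> T" using insert by auto
    then show "?f X = d (X \<inter> S) * p (X \<inter> T)" by simp
  qed auto
  moreover have "mlin (S \<union> T) (\<lambda>X. ?f (insert t X)) z
      = mlin (S \<union> T) (\<lambda>X. d (X \<inter> S) * p (insert t (X \<inter> T))) z"
  proof (rule mlin_cong)
    fix X assume "X \<subseteq> S \<union> T"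
    then have "insert t X \<inter> insert t T = insert t (X \<inter> T)" "insert t X \<inter> S = X \<inter> S" using insert by auto
    then show "?f (insert t X) = d (X \<inter> S) * p (insert t (X \<inter> T))" by simp
  qed auto
  ultimately show ?case
    using insert insert.IH[of p] insert.IH[of "\<lambda>X. p (insert t X)"]
    by (simp add: mlin_insert algebra_simps)
qed

section \<open>Conjugate reversal and factorisation over disjoint sets of variables\<close>

lemma crev_crev: "X \<subseteq> V \<Longrightarrow> crev V (crev V a) X = a X"
  by (simp add: crev_def double_diff)

lemma mlin_crev_mult:
  assumes "finite S" "finite T" "S \<inter> T = {}"
    and "\<And>X. X \<subseteq> S \<union> T \<Longrightarrow> a X = d (X \<inter> S) * p (X \<inter> T)"
  shows "mlin (S \<union> T) (crev (S \<union> T) a) z = mlin S (crev S d) z * mlin T (crev T p) z"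
proof -
  have "crev (S \<union> T) a X = crev S d (X \<inter> S) * crev T p (X \<inter> T)" if "X \<subseteq> S \<union> T" for X
  proof -
    have "(S \<union> T - X) \<inter> S = S - X \<inter> S" "(S \<union> T - X) \<inter> T = T - X \<inter> T" by auto
    then show ?thesis using assms(4)[of "S \<union> T - X"] by (simp add: crev_def)
  qed
  then show ?thesis using assms by (subst mlin_mult) (auto intro!: mlin_cong)
qed

text \<open>On the torus the identity says that \<open>|A|^2 + |B|^2\<close> is constant. The value
  of \<open>c\<close> is left open, as it comes out as a quotient when a product of two such sums is
  split.\<close>

definition gpair :: "'i set \<Rightarrow> ('i set \<Rightarrow> complex) \<Rightarrow> ('i set \<Rightarrow> complex) \<Rightarrow> bool" where
  "gpair V a b \<longleftrightarrow> finite V \<and> (\<forall>X\<subseteq>V. cmod (a X) = 1 \<and> cmod (b X) = 1) \<and>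
     (\<exists>c. c \<noteq> 0 \<and> (\<forall>z. mlin V a z * mlin V (crev V a) z + mlin V b z * mlin V (crev V b) z
        = c * (\<Prod>i\<in>V. z i)))"

text \<open>The cross identity is taken between \<open>z\<close> and the point with the coordinates
  in \<open>U\<close> set to zero, where both polynomials reduce to \<open>mlin (W - U)\<close>. The
  origin is a point at which \<open>mlin W B\<close> is nonzero.\<close>

lemma mlin_factor:
  assumes "finite W" "U \<subseteq> W" "A {} \<noteq> 0" "B {} \<noteq> 0"
    and "\<And>i. i \<in> U \<Longrightarrow> ratio_indep i (mlin W A) (mlin W B)"
  shows "mlin W A z * mlin (W - U) B z = mlin (W - U) A z * mlin W B z"
proof -
  let ?z = "\<lambda>i. if i \<in> U then 0 else z i"
  have fin: "finite U" "finite (W - U)" using assms finite_subset by auto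
  have W: "U \<union> (W - U) = W" using assms by auto
  have "mlin W A z * mlin W B ?z = mlin W A ?z * mlin W B z"
    by (rule ratio_indep_set[OF fin(1) _ _ _ affine_in_mlin affine_in_mlin assms(5), of "\<lambda>i. 0"])
      (use assms in \<open>auto simp: mlin_at_0\<close>)
  moreover have "mlin W C ?z = mlin (W - U) C z" for C
    using mlin_zero[of U "W - U" ?z C] fin W mlin_cong[of "W - U" C C ?z z] by auto
  ultimately show ?thesis by simp
qed

text \<open>There are two passes of \<open>ratio_indep_set\<close>. The pass over \<open>T\<close>
  shows that the quotient of the polynomial by its restriction to \<open>S\<close> is independent of
  each variable of \<open>S\<close>; the pass over \<open>S\<close> then sets these variables to
  zero, where the restriction to \<open>S\<close> is the constant \<open>A {}\<close>.\<close>

lemma mlin_split: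
  assumes "finite S" "finite T" "S \<inter> T = {}" "A {} \<noteq> 0"
    and ij: "\<And>i j. i \<in> S \<Longrightarrow> j \<in> T \<Longrightarrow>
      ratio_indep j (\<lambda>z. mlin (S \<union> T) A (z(i := 0))) (\<lambda>z. mlin (S \<union> T) A (z(i := 1)))"
  shows "mlin (S \<union> T) A z * A {} = mlin S A z * mlin T A z"
proof -
  let ?W = "S \<union> T"
  have fin: "finite ?W" using assms by simp
  have S: "mlin ?W A z' = mlin S A z" if "\<And>i. i \<in> S \<Longrightarrow> z' i = z i" "\<And>i. i \<in> T \<Longrightarrow> z' i = 0" for z z'
    using mlin_zero[of T S z' A] that assms mlin_cong[of S A A z' z] by (simp add: Un_commute Int_commute)
  have "ratio_indep i (mlin ?W A) (mlin S A)" if "i \<in> S" for i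
    unfolding ratio_indep_def
  proof
    fix z :: "'a \<Rightarrow> complex"
    have aff: "affine_in j (\<lambda>z. mlin ?W A (z(i := w)))" if "j \<in> T" for j w
    proof -
      have "i \<noteq> j" using that \<open>i \<in> S\<close> assms(3) by auto
      then show ?thesis
        using affine_in_mlin[OF fin, of j A] unfolding affine_in_def by (metis fun_upd_twist)
    qed
    let ?z = "\<lambda>k. if k \<in> T then 0 else z k"
    \<comment> \<open>For fixed \<open>i\<close> the quotient of the values at
      \<open>z i = 1\<close> and \<open>z i = 0\<close> does not depend on the variables in
      \<open>T\<close>, so these may be set to zero.\<close>
    have "mlin ?W A (z(i := 1)) * mlin ?W A (?z(i := 0)) = mlin ?W A (?z(i := 1)) * mlin ?W A (z(i := 0))"
    proof (rule ratio_indep_set[of T _ _ "\<lambda>k. 0"])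
      fix j assume "j \<in> T"
      with ij[OF that, of j] show "ratio_indep j (\<lambda>z. mlin ?W A (z(i := 1))) (\<lambda>z. mlin ?W A (z(i := 0)))"
        unfolding ratio_indep_def by (metis mult.commute)
    next
      show "polyline (\<lambda>z. mlin ?W A (z(i := 1)))" "polyline (\<lambda>z. mlin ?W A (z(i := 0)))"
        by (rule polyline_upd[OF polyline_mlin])+
      show "mlin ?W A ((\<lambda>k. 0)(i := 0)) \<noteq> 0"
        using assms(4) mlin_at_0[OF fin] by (simp add: fun_upd_idem)
      show "affine_in j (\<lambda>z. mlin ?W A (z(i := 1)))" "affine_in j (\<lambda>z. mlin ?W A (z(i := 0)))"
        if "j \<in> T" for j by (rule aff[OF that])+
      show "z k = ?z k" if "k \<notin> T" for k using that by simp
    qed (rule assms)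
    moreover have "mlin ?W A (?z(i := w)) = mlin S A (z(i := w))" for w
      by (rule S) (use that assms(3) in auto)
    ultimately show "mlin ?W A (z(i := 0)) * mlin S A (z(i := 1)) = mlin ?W A (z(i := 1)) * mlin S A (z(i := 0))"
      by (simp add: mult.commute)
  qed
  note ri = this
  let ?z = "\<lambda>k. if k \<in> S then 0 else z k"
  have "mlin ?W A z * mlin S A ?z = mlin ?W A ?z * mlin S A z"
    by (rule ratio_indep_set[of S _ _ "\<lambda>k. 0"]) (use assms fin ri in \<open>auto simp: mlin_at_0 affine_in_mlin\<close>)
  moreover have "mlin S A ?z = A {}"
    using mlin_cong[of S A A ?z "\<lambda>i. 0"] assms by (simp add: mlin_at_0)
  moreover have "mlin ?W A ?z = mlin T A z"
  proof -
    have "mlin T A ?z = mlin T A z" by (rule mlin_cong) (use assms(3) in auto)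
    then show ?thesis using mlin_zero[of S T ?z A] assms by simp
  qed
  ultimately show ?thesis by (simp add: mult.commute)
qed

section \<open>Splitting off a variable\<close>

lemma mlin_scale: "mlin V (\<lambda>X. c * a X) z = c * mlin V a z"
  by (simp add: mlin_def sum_distrib_left mult.assoc)

lemma mlin_uminus: "mlin V (\<lambda>X. - a X) z = - mlin V a z"
  by (simp add: mlin_def sum_negf)

lemma mlin_crev_uminus: "mlin V (crev V (\<lambda>X. - a X)) z = - mlin V (crev V a) z"
proof -
  have "crev V (\<lambda>X. - a X) = (\<lambda>X. - crev V a X)" by (simp add: crev_def fun_eq_iff)
  then show ?thesis by (simp add: mlin_uminus)
qed

text \<open>Reversal over \<open>insert m W\<close> exchanges the two halves: its part without
  \<open>m\<close> is the reversal of \<open>a1\<close>. The two identities are the coefficients of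
  \<open>z m\<close> to the powers 0 and 1.\<close>

lemma gpair_insertD:
  assumes "gpair (insert m W) a b" "m \<notin> W"
  defines "a1 \<equiv> \<lambda>X. a (insert m X)" and "b1 \<equiv> \<lambda>X. b (insert m X)"
  obtains c where "c \<noteq> 0"
    "\<And>z. mlin W a z * mlin W (crev W a1) z + mlin W b z * mlin W (crev W b1) z = 0"
    "\<And>z. mlin W a z * mlin W (crev W a) z + mlin W a1 z * mlin W (crev W a1) z
        + mlin W b z * mlin W (crev W b) z + mlin W b1 z * mlin W (crev W b1) z = c * (\<Prod>i\<in>W. z i)"
proof -
  let ?V = "insert m W"
  have fin: "finite W" using assms(1) by (simp add: gpair_def)
  obtain c where c: "c \<noteq> 0" and
    eq: "\<And>z. mlin ?V a z * mlin ?V (crev ?V a) z + mlin ?V b z * mlin ?V (crev ?V b) z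
        = c * (\<Prod>i\<in>?V. z i)"
    using assms(1) unfolding gpair_def by blast
  have rev: "mlin ?V (crev ?V f) z = mlin W (crev W (\<lambda>X. f (insert m X))) z + z m * mlin W (crev W f) z" for f z
  proof -
    have 1: "crev ?V f X = crev W (\<lambda>X. f (insert m X)) X" if "X \<subseteq> W" for X
    proof -
      have "insert m W - X = insert m (W - X)" using that assms(2) by auto
      then show ?thesis by (simp add: crev_def)
    qed
    have 2: "crev ?V f (insert m X) = crev W f X" if "X \<subseteq> W" for X
    proof -
      have "insert m W - insert m X = W - X" using that assms(2) by auto
      then show ?thesis by (simp add: crev_def)
    qed
    show ?thesis unfolding mlin_insert[OF fin assms(2)]
      using 1 2 by (intro arg_cong2[where f = "(+)"] arg_cong2[where f = "(*)"] mlin_cong) auto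
  qed
  have upd: "mlin W f (z(m := w)) = mlin W f z" for f z w
    by (rule mlin_cong) (use assms(2) in auto)
  have pupd: "(\<Prod>i\<in>?V. (z(m := w)) i) = w * (\<Prod>i\<in>W. z i)" for z :: "'a \<Rightarrow> complex" and w
  proof -
    have "(\<Prod>i\<in>W. (z(m := w)) i) = (\<Prod>i\<in>W. z i)" using assms(2) by (intro prod.cong) auto
    then show ?thesis using fin assms(2) by simp
  qed
  have main: "(mlin W a z + w * mlin W a1 z) * (mlin W (crev W a1) z + w * mlin W (crev W a) z)
     + (mlin W b z + w * mlin W b1 z) * (mlin W (crev W b1) z + w * mlin W (crev W b) z)
     = c * (w * (\<Prod>i\<in>W. z i))" for z w
    using eq[of "z(m := w)"]
    unfolding rev unfolding mlin_insert[OF fin assms(2)] upd pupd fun_upd_same a1_def b1_def .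
  show ?thesis
  proof
    show "c \<noteq> 0" by fact
    fix z
    show 0: "mlin W a z * mlin W (crev W a1) z + mlin W b z * mlin W (crev W b1) z = 0"
      using main[of z 0] by simp
    \<comment> \<open>The values at \<open>1\<close> and \<open>-1\<close> isolate the coefficient
      of \<open>w\<close> in an expression quadratic in \<open>w\<close>.\<close>
    show "mlin W a z * mlin W (crev W a) z + mlin W a1 z * mlin W (crev W a1) z
        + mlin W b z * mlin W (crev W b) z + mlin W b1 z * mlin W (crev W b1) z = c * (\<Prod>i\<in>W. z i)"
      using main[of z 1] main[of z "-1"] 0 by algebra
  qed
qed

text \<open>With the variables in \<open>S\<close> set to 1, the first factor becomes a constant,
  which is nonzero because \<open>c\<close> is; dividing by it leaves the identity of a pair on
  \<open>T\<close>.\<close>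

lemma gpair_product:
  assumes "finite S" "finite T" "S \<inter> T = {}" "c \<noteq> 0"
    and eq: "\<And>z. (mlin S d z * mlin S (crev S d) z + mlin S e z * mlin S (crev S e) z) *
      (mlin T p z * mlin T (crev T p) z + mlin T q z * mlin T (crev T q) z)
      = c * ((\<Prod>i\<in>S. z i) * (\<Prod>i\<in>T. z i))"
    and uni: "\<And>X. X \<subseteq> T \<Longrightarrow> cmod (p X) = 1 \<and> cmod (q X) = 1"
  shows "gpair T p q"
proof -
  let ?G = "\<lambda>z. mlin S d z * mlin S (crev S d) z + mlin S e z * mlin S (crev S e) z"
  let ?H = "\<lambda>z. mlin T p z * mlin T (crev T p) z + mlin T q z * mlin T (crev T q) z"
  have g: "?G (\<lambda>i. 1) * ?H z = c * (\<Prod>i\<in>T. z i)" for z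
  proof -
    let ?z = "\<lambda>i. if i \<in> T then z i else 1"
    have "mlin S f ?z = mlin S f (\<lambda>i. 1)" for f by (rule mlin_cong) (use assms(3) in auto)
    moreover have "mlin T f ?z = mlin T f z" for f by (rule mlin_cong) auto
    moreover have "(\<Prod>i\<in>S. ?z i) = 1" by (rule prod.neutral) (use assms(3) in auto)
    moreover have "(\<Prod>i\<in>T. ?z i) = (\<Prod>i\<in>T. z i)" by (rule prod.cong) auto
    ultimately show ?thesis using eq[of ?z] by simp
  qed
  have g0: "?G (\<lambda>i. 1) \<noteq> 0" using g[of "\<lambda>i. 1"] \<open>c \<noteq> 0\<close> by auto
  then have "?H z = c / ?G (\<lambda>i. 1) * (\<Prod>i\<in>T. z i)" for z
    using g[of z] by (simp add: nonzero_eq_divide_eq mult.commute)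
  then show ?thesis
    unfolding gpair_def using assms(2) uni g0 \<open>c \<noteq> 0\<close> by (metis divide_eq_0_iff)
qed

lemma gpair_decompose:
  assumes "gpair (insert m W) a b" "m \<notin> W"
  obtains S T d e p q where "S \<union> T = W" "S \<inter> T = {}" "gpair S d e" "gpair T p q"
    "\<And>X. X \<subseteq> W \<Longrightarrow> a X = d (X \<inter> S) * p (X \<inter> T)"
    "\<And>X. X \<subseteq> W \<Longrightarrow> b X = d (X \<inter> S) * q (X \<inter> T)"
    "\<And>X. X \<subseteq> W \<Longrightarrow> a (insert m X) = - crev S e (X \<inter> S) * crev T q (X \<inter> T)"
    "\<And>X. X \<subseteq> W \<Longrightarrow> b (insert m X) = crev S e (X \<inter> S) * crev T p (X \<inter> T)"
proof -
  define a1 b1 where "a1 = (\<lambda>X. a (insert m X))" and "b1 = (\<lambda>X. b (insert m X))"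
  obtain c where c: "c \<noteq> 0" and
    eq0: "\<And>z. mlin W a z * mlin W (crev W a1) z + mlin W b z * mlin W (crev W b1) z = 0" and
    eq1: "\<And>z. mlin W a z * mlin W (crev W a) z + mlin W a1 z * mlin W (crev W a1) z
        + mlin W b z * mlin W (crev W b) z + mlin W b1 z * mlin W (crev W b1) z = c * (\<Prod>i\<in>W. z i)"
    using gpair_insertD[OF assms] unfolding a1_def b1_def by blast
  have fin: "finite W" and uni: "cmod (a X) = 1" "cmod (b X) = 1" if "X \<subseteq> insert m W" for X
    using assms(1) that by (auto simp: gpair_def)
  then have fin: "finite W" by blast
  define A B C E where ABCE: "A = mlin W a" "B = mlin W b" "C = mlin W (crev W a1)" "E = mlin W (crev W b1)"
  have pl: "polyline A" "polyline B" "polyline C" "polyline E" unfolding ABCE by (rule polyline_mlin)+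
  have aff: "affine_in i A" "affine_in i B" "affine_in i C" "affine_in i E" for i
    unfolding ABCE by (rule affine_in_mlin[OF fin])+
  have eq0': "A z * C z = - (B z * E z)" for z using eq0[of z] unfolding ABCE by (simp add: eq_neg_iff_add_eq_0)
  \<comment> \<open>For the variables in \<open>T\<close>, \<open>ratio_indep_cases\<close> makes
    the quotient of \<open>A\<close> by \<open>E\<close> independent instead.\<close>
  define S T where "S = {i \<in> W. ratio_indep i A B}" and "T = W - S"
  have ST: "S \<union> T = W" "S \<inter> T = {}" "W - T = S" "W - S = T" by (auto simp: S_def T_def)
  have finST: "finite S" "finite T" using fin ST by (metis finite_Un)+
  define e where "e = crev W b1"
  \<comment> \<open>\<open>mlin_split\<close> factors \<open>A\<close> times \<open>a {}\<close>;
    dividing the factor on \<open>T\<close> by \<open>u\<close> makes this a factorisation of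
    \<open>A\<close>, and \<open>q\<close> is scaled alike so that \<open>A\<close> and
    \<open>B\<close> share the factor on \<open>S\<close>.\<close>
  define u where "u = a {}"
  have u: "cmod u = 1" "u \<noteq> 0" using uni(1)[of "{}"] by (auto simp: u_def)
  have b: "b {} \<noteq> 0" using uni(2)[of "{}"] by auto
  have ue: "cmod (e X) = 1" for X using uni(2)[of "insert m (W - X)"] by (auto simp: e_def crev_def b1_def)
  define p q where "p = (\<lambda>X. inverse u * a X)" and "q = (\<lambda>X. inverse u * b X)"
  have pz: "mlin T a z = u * mlin T p z" and qz: "mlin T b z = u * mlin T q z" for z
    using u by (simp_all add: p_def q_def mlin_scale)
  have split: "A z * u = mlin S a z * mlin T a z" for z
    unfolding ABCE u_def ST(1)[symmetric]
  proof (rule mlin_split)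
    fix i j assume "i \<in> S" "j \<in> T"
    then have "i \<noteq> j" "ratio_indep i A B" "\<not> ratio_indep j A B" by (auto simp: S_def T_def)
    then show "ratio_indep j (\<lambda>z. mlin (S \<union> T) a (z(i := 0))) (\<lambda>z. mlin (S \<union> T) a (z(i := 1)))"
      using ratio_indep_split[of A B i j] pl aff unfolding ABCE ST by blast
  qed (use finST ST u in \<open>auto simp: u_def\<close>)
  then have Az: "A z = mlin S a z * mlin T p z" for z
    using u pz[of z] by (metis mult.commute mult.left_commute mult_left_cancel)
  have Bz: "B z = mlin S a z * mlin T q z" for z
  proof (rule polyline_cancel[of "mlin T p" B])
    fix z
    \<comment> \<open>Setting the variables of \<open>S\<close> to zero does not change the quotient
      of \<open>A\<close> by \<open>B\<close>.\<close>
    have "A z * mlin T b z = mlin T a z * B z"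
      unfolding ABCE ST(4)[symmetric]
    proof (rule mlin_factor[OF fin])
      fix i assume "i \<in> S"
      then show "ratio_indep i (mlin W a) (mlin W b)" unfolding S_def ABCE by simp
    qed (use u b in \<open>auto simp: S_def u_def\<close>)
    then have "u * (mlin T p z * B z) = u * (mlin T p z * (mlin S a z * mlin T q z))"
      unfolding pz qz Az by (simp only: mult_ac)
    then show "mlin T p z * B z = mlin T p z * (mlin S a z * mlin T q z)" using u by simp
  next
    show "mlin T p (\<lambda>i. 0) \<noteq> 0" using finST u by (simp add: mlin_at_0 p_def u_def)
  qed (auto intro: polyline_mult pl)
  have Ez: "E z = mlin S e z * mlin T p z" for z
  proof (rule polyline_cancel[of "mlin S a" E])
    fix z
    \<comment> \<open>The same with the variables of \<open>T\<close> and the quotient of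
      \<open>A\<close> by \<open>E\<close>.\<close>
    have "A z * mlin S e z = mlin S a z * E z"
      unfolding ABCE e_def ST(3)[symmetric]
    proof (rule mlin_factor[OF fin])
      fix i assume "i \<in> T"
      then have "\<not> ratio_indep i A B" by (auto simp: S_def T_def)
      then show "ratio_indep i (mlin W a) (mlin W (crev W b1))"
        using ratio_indep_cases[OF pl(1,2,4) aff eq0', of i] unfolding ABCE by blast
    qed (use u ue[of "{}"] in \<open>auto simp: T_def u_def e_def\<close>)
    then show "mlin S a z * E z = mlin S a z * (mlin S e z * mlin T p z)" unfolding Az by algebra
  next
    show "mlin S a (\<lambda>i. 0) \<noteq> 0" using finST u by (simp add: mlin_at_0 u_def)
  qed (auto intro: polyline_mult pl)
  have Cz: "C z = mlin S (\<lambda>X. - e X) z * mlin T q z" for z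
  proof (rule polyline_cancel[of A C])
    fix z
    \<comment> \<open>The product of \<open>B\<close> and \<open>E\<close> contains \<open>A\<close>
      as the product of \<open>mlin S a\<close> and \<open>mlin T p\<close>.\<close>
    show "A z * C z = A z * (mlin S (\<lambda>X. - e X) z * mlin T q z)"
      unfolding eq0' mlin_uminus unfolding Az Bz Ez by (simp add: mult_ac)
  next
    show "A (\<lambda>i. 0) \<noteq> 0" using fin u by (simp add: mlin_at_0 u_def ABCE)
  qed (auto intro: polyline_mult pl)
  note coeff = mlin_eqD[OF fin, OF trans[OF _ mlin_mult[OF finST ST(2), unfolded ST(1)]]]
  have ca: "a X = a (X \<inter> S) * p (X \<inter> T)" if "X \<subseteq> W" for X
    by (rule coeff[OF Az[unfolded ABCE] that])
  have cb: "b X = a (X \<inter> S) * q (X \<inter> T)" if "X \<subseteq> W" for X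
    by (rule coeff[OF Bz[unfolded ABCE] that])
  have ce: "crev W b1 X = e (X \<inter> S) * p (X \<inter> T)" if "X \<subseteq> W" for X
    by (rule coeff[OF Ez[unfolded ABCE] that])
  have cc: "crev W a1 X = - e (X \<inter> S) * q (X \<inter> T)" if "X \<subseteq> W" for X
    by (rule coeff[OF Cz[unfolded ABCE] that])
  note cm = mlin_crev_mult[OF finST ST(2), unfolded ST(1)]
  \<comment> \<open>The factorisations are known for the reversals of \<open>a1\<close> and
    \<open>b1\<close>; reversing once more gives them for \<open>a1\<close> and
    \<open>b1\<close>.\<close>
  have "mlin W a1 z = mlin W (crev W (crev W a1)) z" "mlin W b1 z = mlin W (crev W (crev W b1)) z" for z
    by (rule mlin_cong; simp add: crev_crev)+
  then have
    "mlin W a1 z = - mlin S (crev S e) z * mlin T (crev T q) z"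
    "mlin W b1 z = mlin S (crev S e) z * mlin T (crev T p) z"
    "mlin W (crev W a) z = mlin S (crev S a) z * mlin T (crev T p) z"
    "mlin W (crev W b) z = mlin S (crev S a) z * mlin T (crev T q) z" for z
    using cm[of a a p z] ca cm[of b a q z] cb cm[of "crev W b1" e p z] ce
      cm[of "crev W a1" "\<lambda>X. - e X" q z] cc
    unfolding mlin_crev_uminus by simp_all
  note rs = this
  \<comment> \<open>The four terms of \<open>eq1\<close> are exactly the expansion of this
    product.\<close>
  have eq: "(mlin S a z * mlin S (crev S a) z + mlin S e z * mlin S (crev S e) z) *
      (mlin T p z * mlin T (crev T p) z + mlin T q z * mlin T (crev T q) z)
      = c * ((\<Prod>i\<in>S. z i) * (\<Prod>i\<in>T. z i))" for z
  proof -
    have "(\<Prod>i\<in>W. z i) = (\<Prod>i\<in>S. z i) * (\<Prod>i\<in>T. z i)"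
      unfolding ST(1)[symmetric] using finST ST by (intro prod.union_disjoint) auto
    then show ?thesis
      using eq1[of z] Az[of z] Bz[of z] Cz[of z] Ez[of z]
      unfolding rs ABCE mlin_uminus by (simp add: algebra_simps)
  qed
  have upq: "cmod (p X) = 1" "cmod (q X) = 1" if "X \<subseteq> W" for X
    using uni[of X] that u by (auto simp: p_def q_def norm_mult norm_inverse)
  show ?thesis
  proof (rule that[of S T a e p q])
    show "gpair T p q"
      by (rule gpair_product[OF finST ST(2) c eq]) (use upq ST(1) in auto)
    show "gpair S a e"
    proof (rule gpair_product[OF finST(2,1) _ c])
      show "(mlin T p z * mlin T (crev T p) z + mlin T q z * mlin T (crev T q) z) *
          (mlin S a z * mlin S (crev S a) z + mlin S e z * mlin S (crev S e) z)
        = c * ((\<Prod>i\<in>T. z i) * (\<Prod>i\<in>S. z i))" for z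
        using eq[of z] by (simp only: mult.commute)
      show "cmod (a X) = 1 \<and> cmod (e X) = 1" if "X \<subseteq> S" for X
        using uni(1)[of X] ue that ST(1) by blast
    qed (use ST in auto)
    fix X assume X: "X \<subseteq> W"
    have int: "(W - X) \<inter> S = S - X \<inter> S" "(W - X) \<inter> T = T - X \<inter> T" using ST(1) by auto
    have "a (insert m X) = cnj (crev W a1 (W - X))" "b (insert m X) = cnj (crev W b1 (W - X))"
      using X by (simp_all add: crev_def a1_def b1_def double_diff)
    then show "a (insert m X) = - crev S e (X \<inter> S) * crev T q (X \<inter> T)"
      "b (insert m X) = crev S e (X \<inter> S) * crev T p (X \<inter> T)"
      using cc[of "W - X"] ce[of "W - X"] by (simp_all add: int crev_def[of S] crev_def[of T])
  qed (use ST ca cb in auto)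
qed

section \<open>Path signs\<close>

definition sgn_at :: "'i \<Rightarrow> 'i set \<Rightarrow> complex" where
  "sgn_at i X = (if i \<in> X then - 1 else 1)"

definition hd_sgn :: "'i list \<Rightarrow> 'i set \<Rightarrow> complex" where
  "hd_sgn l X = (if l = [] then 1 else sgn_at (hd l) X)"

text \<open>This is \<open>-1\<close> to the number of pairs of neighbouring entries that both lie
  in \<open>X\<close>, the quadratic part of a standard array. The value 1 of \<open>hd_sgn\<close>
  at the empty list covers the last entry, which has no successor.\<close>

fun path_sgn :: "'i list \<Rightarrow> 'i set \<Rightarrow> complex" where
  "path_sgn [] X = 1"
| "path_sgn (x # l) X = (if x \<in> X then hd_sgn l X else 1) * path_sgn l X"

lemma hd_sgn_simps [simp]: "hd_sgn [] X = 1" "hd_sgn (x # l) X = sgn_at x X"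
  by (simp_all add: hd_sgn_def)

lemma hd_sgn_append: "hd_sgn (l @ r) X = (if l = [] then hd_sgn r X else hd_sgn l X)"
  by (simp add: hd_sgn_def)

lemma hd_sgn_cases: "hd_sgn l X = 1 \<or> hd_sgn l X = - 1"
  by (simp add: hd_sgn_def sgn_at_def)

lemma hd_sgn_cong: "set l \<inter> X = set l \<inter> Y \<Longrightarrow> hd_sgn l X = hd_sgn l Y"
  by (cases l) (auto simp: sgn_at_def)

lemma path_sgn_cong: "set l \<inter> X = set l \<inter> Y \<Longrightarrow> path_sgn l X = path_sgn l Y"
proof (induction l)
  case (Cons x l)
  then have "set l \<inter> X = set l \<inter> Y" "x \<in> X \<longleftrightarrow> x \<in> Y" by auto
  with Cons.IH hd_sgn_cong[of l X Y] show ?case by simp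
qed simp

lemma path_sgn_snoc:
  "path_sgn (l @ [x]) X = (if x \<in> X then hd_sgn (rev l) X else 1) * path_sgn l X"
proof (induction l)
  case (Cons y l)
  then show ?case by (cases l) (auto simp: hd_sgn_append sgn_at_def)
qed simp

lemma path_sgn_rev: "path_sgn (rev l) X = path_sgn l X"
  by (induction l) (simp_all add: path_sgn_snoc)

text \<open>Every edge of the path lies on one side of the vertex \<open>m\<close>.\<close>

lemma path_sgn_append_Cons:
  "path_sgn (l @ m # r) X = path_sgn (l @ [m]) X * path_sgn (m # r) X"
proof (induction l)
  case (Cons y l)
  then show ?case by (cases l) auto
qed simp

lemma path_sgn_middle:
  assumes "m \<notin> X"
  shows "path_sgn (l @ m # r) X = path_sgn l X * path_sgn r X"
    and "path_sgn (l @ m # r) (insert m X) =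
      path_sgn l (insert m X) * path_sgn r (insert m X) * hd_sgn (rev l) (insert m X) * hd_sgn r (insert m X)"
  using assms by (simp_all add: path_sgn_append_Cons[of l m r] path_sgn_snoc)

lemma hd_sgn_compl: "set l \<subseteq> V \<Longrightarrow> hd_sgn l (V - X) = (if l = [] then 1 else - hd_sgn l X)"
  by (cases l) (auto simp: sgn_at_def)

text \<open>When each \<open>x\<close> becomes \<open>1 - x\<close> in the sum of products of
  neighbours, every inner variable occurs twice in the new linear part and cancels modulo 2. Only
  the signs at the two ends remain, with a constant sign for the number of edges.\<close>

lemma path_sgn_compl:
  assumes "set l \<subseteq> V"
  obtains k where "cmod k = 1"
    "\<And>X. path_sgn l (V - X) = k * path_sgn l X * hd_sgn l X * hd_sgn (rev l) X"
proof -
  have "\<exists>k. cmod k = 1 \<and> (\<forall>X. path_sgn l (V - X) = k * path_sgn l X * hd_sgn l X * hd_sgn (rev l) X)"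
    using assms
  proof (induction l)
    case Nil
    then show ?case by (intro exI[of _ 1]) simp
  next
    case (Cons x l)
    then obtain k where k: "cmod k = 1"
      "\<And>X. path_sgn l (V - X) = k * path_sgn l X * hd_sgn l X * hd_sgn (rev l) X" by auto
    show ?case
    proof (cases l)
      case Nil
      then show ?thesis by (intro exI[of _ 1]) (auto simp: sgn_at_def)
    next
      case (Cons y r)
      have "path_sgn (x # l) (V - X) =
          (- k) * path_sgn (x # l) X * hd_sgn (x # l) X * hd_sgn (rev (x # l)) X" for X
        using k(2)[of X] hd_sgn_compl[of l V X] Cons.prems Cons
        by (auto simp: sgn_at_def hd_sgn_append simp del: path_sgn.simps(2) simp: path_sgn.simps(2)[of x])
      with k(1) show ?thesis by (intro exI[of _ "- k"]) auto
    qed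
  qed
  then show ?thesis using that by blast
qed

section \<open>Standard pairs on a path and how they are joined\<close>

definition standard_on :: "'i list \<Rightarrow> ('i set \<Rightarrow> complex) \<Rightarrow> ('i set \<Rightarrow> complex) \<Rightarrow> bool" where
  "standard_on l a b \<longleftrightarrow> (\<exists>\<chi> u v. cmod u = 1 \<and> cmod v = 1 \<and> (\<forall>i. cmod (\<chi> i) = 1) \<and>
     (\<forall>X \<subseteq> set l. a X = u * (\<Prod>i\<in>X. \<chi> i) * path_sgn l X \<and> b X = v * a X * hd_sgn l X))"

lemma standard_onE:
  assumes "standard_on l a b"
  obtains u v \<chi> where "cmod u = 1" "cmod v = 1" "\<And>i. cmod (\<chi> i) = 1"
    "\<And>X. X \<subseteq> set l \<Longrightarrow> a X = u * (\<Prod>i\<in>X. \<chi> i) * path_sgn l X"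
    "\<And>X. X \<subseteq> set l \<Longrightarrow> b X = v * a X * hd_sgn l X"
proof -
  from assms obtain \<chi> u v where *: "cmod u = 1" "cmod v = 1" "\<forall>i. cmod (\<chi> i) = 1"
    "\<forall>X \<subseteq> set l. a X = u * (\<Prod>i\<in>X. \<chi> i) * path_sgn l X \<and> b X = v * a X * hd_sgn l X"
    unfolding standard_on_def by (elim exE conjE)
  show ?thesis by (rule that[of u v \<chi>]) (use * in blast)+
qed

lemma cnj_unimodular: "cmod w = 1 \<Longrightarrow> cnj w * w = 1"
  by (metis complex_norm_square mult.commute of_real_1 one_power2)

lemma cnj_hd_sgn [simp]: "cnj (hd_sgn l X) = hd_sgn l X"
  using hd_sgn_cases[of l X] by auto

lemma cnj_path_sgn [simp]: "cnj (path_sgn l X) = path_sgn l X"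
  by (induction l) auto

lemma hd_sgn_square [simp]: "hd_sgn l X * hd_sgn l X = 1"
  using hd_sgn_cases[of l X] by auto

text \<open>Complementing and conjugating each invert the factors \<open>\<chi> i\<close>, so the
  linear part survives. The path sign acquires the signs of both ends, and the one at the head
  cancels against that in \<open>b\<close>.\<close>

lemma crev_standard:
  assumes "cmod u = 1" "cmod v = 1" "\<And>i. cmod (\<chi> i) = 1"
    and a: "\<And>X. X \<subseteq> set l \<Longrightarrow> a X = u * (\<Prod>i\<in>X. \<chi> i) * path_sgn l X"
    and b: "\<And>X. X \<subseteq> set l \<Longrightarrow> b X = v * a X * hd_sgn l X"
  obtains w where "cmod w = 1"
    "\<And>X. X \<subseteq> set l \<Longrightarrow> crev (set l) b X = w * (\<Prod>i\<in>X. \<chi> i) * path_sgn l X * hd_sgn (rev l) X"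
proof -
  obtain k where k: "cmod k = 1"
    "\<And>X. path_sgn l (set l - X) = k * path_sgn l X * hd_sgn l X * hd_sgn (rev l) X"
    using path_sgn_compl[of l "set l"] by auto
  \<comment> \<open>Complementing flips the head sign, except on the empty list.\<close>
  define s where "s = (if l = [] then 1 else - 1 :: complex)"
  define w where "w = cnj v * cnj u * cnj (\<Prod>i\<in>set l. \<chi> i) * cnj k * s"
  have pm: "cmod (\<Prod>i\<in>Y. \<chi> i) = 1" for Y using assms(3) by (simp add: prod_norm[symmetric])
  have "cmod w = 1" using assms(1,2) k(1) pm by (simp add: w_def s_def norm_mult del: cnj_prod)
  moreover have "crev (set l) b X = w * (\<Prod>i\<in>X. \<chi> i) * path_sgn l X * hd_sgn (rev l) X"
    if X: "X \<subseteq> set l" for X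
  proof -
    let ?Y = "set l - X"
    have "(\<Prod>i\<in>set l. \<chi> i) = (\<Prod>i\<in>?Y. \<chi> i) * (\<Prod>i\<in>X. \<chi> i)"
      by (rule prod.subset_diff[OF X]) simp
    then have chi: "cnj (\<Prod>i\<in>?Y. \<chi> i) = cnj (\<Prod>i\<in>set l. \<chi> i) * (\<Prod>i\<in>X. \<chi> i)"
      using cnj_unimodular[OF pm, of X] by (simp add: mult.assoc del: cnj_prod)
    have hs: "hd_sgn l ?Y = s * hd_sgn l X" using hd_sgn_compl[of l "set l" X] by (simp add: s_def)
    have "crev (set l) b X = cnj v * cnj u * cnj (\<Prod>i\<in>?Y. \<chi> i) * cnj (path_sgn l ?Y) * cnj (hd_sgn l ?Y)"
      unfolding crev_def using a[of ?Y] b[of ?Y] by (simp add: mult.assoc del: cnj_prod cnj_hd_sgn cnj_path_sgn)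
    also have "\<dots> = cnj v * cnj u * cnj (\<Prod>i\<in>set l. \<chi> i) * (\<Prod>i\<in>X. \<chi> i)
        * (cnj k * path_sgn l X * hd_sgn l X * hd_sgn (rev l) X) * (s * hd_sgn l X)"
      unfolding chi hs k(2) by (simp add: mult.assoc s_def del: cnj_prod)
    also have "\<dots> = w * (\<Prod>i\<in>X. \<chi> i) * path_sgn l X * hd_sgn (rev l) X * (hd_sgn l X * hd_sgn l X)"
      by (simp only: w_def mult_ac)
    finally show ?thesis by simp
  qed
  ultimately show ?thesis using that by blast
qed

text \<open>On the complement of \<open>X\<close> the relation is solved for \<open>a\<close>: the
  head sign is its own inverse, and conjugation inverts \<open>v\<close>.\<close>

lemma crev_ratio:
  assumes "cmod v = 1" "\<And>X. X \<subseteq> set l \<Longrightarrow> b X = v * a X * hd_sgn l X"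
  shows "crev (set l) a X = v * crev (set l) b X * hd_sgn l (set l - X)"
proof -
  let ?Y = "set l - X"
  have "b ?Y = v * a ?Y * hd_sgn l ?Y" by (rule assms(2)) auto
  then have "v * crev (set l) b X * hd_sgn l ?Y
      = (cnj v * v) * cnj (a ?Y) * (hd_sgn l ?Y * hd_sgn l ?Y)"
    unfolding crev_def by simp
  then show ?thesis using cnj_unimodular[OF assms(1)] by (simp add: crev_def)
qed

text \<open>By \<open>crev_standard\<close> the two reversals bring in the signs at the last entries
  of \<open>lT\<close> and \<open>lS\<close>. These are the two edges at \<open>m\<close>, so the
  path is \<open>lT\<close>, then \<open>m\<close>, then \<open>lS\<close> backwards.\<close>

lemma standard_on_join:
  assumes S: "standard_on lS d e" and T: "standard_on lT p q"
    and disj: "set lS \<inter> set lT = {}" "m \<notin> set lS" "m \<notin> set lT"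
    and W: "W = set lS \<union> set lT"
    and a0: "\<And>X. X \<subseteq> W \<Longrightarrow> a X = d (X \<inter> set lS) * p (X \<inter> set lT)"
    and b0: "\<And>X. X \<subseteq> W \<Longrightarrow> b X = d (X \<inter> set lS) * q (X \<inter> set lT)"
    and a1: "\<And>X. X \<subseteq> W \<Longrightarrow> a (insert m X) = - crev (set lS) e (X \<inter> set lS) * crev (set lT) q (X \<inter> set lT)"
    and b1: "\<And>X. X \<subseteq> W \<Longrightarrow> b (insert m X) = crev (set lS) e (X \<inter> set lS) * crev (set lT) p (X \<inter> set lT)"
  shows "standard_on (lT @ m # rev lS) a b"
proof -
  let ?S = "set lS" and ?T = "set lT" and ?l = "lT @ m # rev lS"
  from S obtain uS vS \<psi> where S: "cmod uS = 1" "cmod vS = 1" "\<And>i. cmod (\<psi> i) = 1"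
    "\<And>X. X \<subseteq> ?S \<Longrightarrow> d X = uS * (\<Prod>i\<in>X. \<psi> i) * path_sgn lS X"
    "\<And>X. X \<subseteq> ?S \<Longrightarrow> e X = vS * d X * hd_sgn lS X"
    by (rule standard_onE) (rule that)
  from T obtain uT vT \<chi> where T: "cmod uT = 1" "cmod vT = 1" "\<And>i. cmod (\<chi> i) = 1"
    "\<And>X. X \<subseteq> ?T \<Longrightarrow> p X = uT * (\<Prod>i\<in>X. \<chi> i) * path_sgn lT X"
    "\<And>X. X \<subseteq> ?T \<Longrightarrow> q X = vT * p X * hd_sgn lT X"
    by (rule standard_onE) (rule that)
  obtain wS where wS: "cmod wS = 1"
    "\<And>X. X \<subseteq> ?S \<Longrightarrow> crev ?S e X = wS * (\<Prod>i\<in>X. \<psi> i) * path_sgn lS X * hd_sgn (rev lS) X"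
    using crev_standard[OF S(1-5)] by blast
  obtain wT where wT: "cmod wT = 1"
    "\<And>X. X \<subseteq> ?T \<Longrightarrow> crev ?T q X = wT * (\<Prod>i\<in>X. \<chi> i) * path_sgn lT X * hd_sgn (rev lT) X"
    using crev_standard[OF T(1-5)] by blast
  define u where "u = uS * uT"
  \<comment> \<open>The factor at \<open>m\<close> is forced by
    \<open>u * \<omega> m = - wS * wT\<close>, the constant of the part of \<open>a\<close> with
    \<open>m\<close>.\<close>
  define \<omega> where "\<omega> i = (if i \<in> ?S then \<psi> i else if i \<in> ?T then \<chi> i else - wS * wT / u)" for i
  have u: "cmod u = 1" "u \<noteq> 0" using S(1) T(1) by (auto simp: u_def norm_mult)
  have om: "cmod (\<omega> i) = 1" for i
    using S(3) T(3) wS(1) wT(1) u by (simp add: \<omega>_def norm_mult norm_divide)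
  have prod_om: "(\<Prod>i\<in>X. \<omega> i) = (\<Prod>i\<in>X \<inter> ?S. \<psi> i) * (\<Prod>i\<in>X \<inter> ?T. \<chi> i)" if "X \<subseteq> W" for X
  proof -
    have "X = (X \<inter> ?S) \<union> (X \<inter> ?T)" using that W by auto
    then have "(\<Prod>i\<in>X. \<omega> i) = (\<Prod>i\<in>(X \<inter> ?S) \<union> (X \<inter> ?T). \<omega> i)" by (rule arg_cong)
    also have "\<dots> = (\<Prod>i\<in>X \<inter> ?S. \<omega> i) * (\<Prod>i\<in>X \<inter> ?T. \<omega> i)"
      using disj by (intro prod.union_disjoint) auto
    also have "\<dots> = (\<Prod>i\<in>X \<inter> ?S. \<psi> i) * (\<Prod>i\<in>X \<inter> ?T. \<chi> i)"
      using disj by (intro arg_cong2[where f = "(*)"] prod.cong) (auto simp: \<omega>_def)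
    finally show ?thesis .
  qed
  have lT: "path_sgn lT (X \<inter> ?T) = path_sgn lT X" "hd_sgn lT (X \<inter> ?T) = hd_sgn lT X"
    "hd_sgn (rev lT) (X \<inter> ?T) = hd_sgn (rev lT) X"
    "path_sgn lT (insert m X) = path_sgn lT X" "hd_sgn lT (insert m X) = hd_sgn lT X"
    "hd_sgn (rev lT) (insert m X) = hd_sgn (rev lT) X" for X
    using disj by (auto intro!: path_sgn_cong hd_sgn_cong)
  have lS: "path_sgn lS (X \<inter> ?S) = path_sgn lS X"
    "hd_sgn (rev lS) (X \<inter> ?S) = hd_sgn (rev lS) X"
    "path_sgn lS (insert m X) = path_sgn lS X"
    "hd_sgn (rev lS) (insert m X) = hd_sgn (rev lS) X" for X
    using disj by (auto intro!: path_sgn_cong hd_sgn_cong)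
  have main: "a X = u * (\<Prod>i\<in>X. \<omega> i) * path_sgn ?l X \<and> b X = vT * a X * hd_sgn ?l X \<and>
      a (insert m X) = u * (\<Prod>i\<in>insert m X. \<omega> i) * path_sgn ?l (insert m X) \<and>
      b (insert m X) = vT * a (insert m X) * hd_sgn ?l (insert m X)" if X: "X \<subseteq> W" for X
  proof (intro conjI)
    have mX: "m \<notin> X" using X W disj by auto
    have finX: "finite X" using X W finite_subset by blast
    have om_m: "\<omega> m = - wS * wT / u" using disj by (simp add: \<omega>_def)
    show "a X = u * (\<Prod>i\<in>X. \<omega> i) * path_sgn ?l X"
      using mX by (simp add: a0[OF X] S(4) T(4) lT lS prod_om[OF X] path_sgn_middle path_sgn_rev u_def mult_ac)
    show "b X = vT * a X * hd_sgn ?l X"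
    proof (cases "lT = []")
      case True
      then show ?thesis using mX by (simp add: a0[OF X] b0[OF X] T(5) sgn_at_def)
    next
      case False
      then show ?thesis by (simp add: a0[OF X] b0[OF X] T(5) lT hd_sgn_append)
    qed
    show "a (insert m X) = u * (\<Prod>i\<in>insert m X. \<omega> i) * path_sgn ?l (insert m X)"
    proof -
      have "(\<Prod>i\<in>insert m X. \<omega> i) = \<omega> m * (\<Prod>i\<in>X. \<omega> i)" using mX finX by simp
      moreover have "u * (\<omega> m * r) = - wS * wT * r" for r using om_m u by simp
      ultimately show ?thesis
        unfolding a1[OF X] path_sgn_middle(2)[OF mX] path_sgn_rev lT lS prod_om[OF X]
        by (simp only: wS(2)[OF Int_lower2] wT(2)[OF Int_lower2] lT lS) (simp add: mult_ac)
    qed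
    have "crev ?T p (X \<inter> ?T) = vT * crev ?T q (X \<inter> ?T) * hd_sgn lT (?T - X \<inter> ?T)"
      by (rule crev_ratio[OF T(2,5)])
    \<comment> \<open>For empty \<open>lT\<close> both sides are 1: the head of the new path is
      \<open>m\<close>, which lies in \<open>insert m X\<close>.\<close>
    moreover have "hd_sgn lT (?T - X \<inter> ?T) = - hd_sgn ?l (insert m X)"
      using hd_sgn_compl[of lT ?T "X \<inter> ?T"] by (simp add: hd_sgn_append lT sgn_at_def)
    ultimately show "b (insert m X) = vT * a (insert m X) * hd_sgn ?l (insert m X)"
      by (simp add: a1[OF X] b1[OF X])
  qed
  have "a X = u * (\<Prod>i\<in>X. \<omega> i) * path_sgn ?l X \<and> b X = vT * a X * hd_sgn ?l X" if "X \<subseteq> set ?l" for X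
  proof (cases "m \<in> X")
    case True
    then have "X - {m} \<subseteq> W" "insert m (X - {m}) = X" using that W by auto
    with main[of "X - {m}"] show ?thesis by metis
  next
    case False
    then have "X \<subseteq> W" using that W by auto
    with main show ?thesis by blast
  qed
  then show ?thesis
    unfolding standard_on_def
    by (intro exI[of _ \<omega>] exI[of _ u] exI[of _ vT] conjI allI impI u(1) T(2) om) auto
qed

theorem gpair_standard:
  assumes "gpair V a b"
  obtains l where "set l = V" "distinct l" "standard_on l a b"
proof -
  have "\<exists>l. set l = V \<and> distinct l \<and> standard_on l a b"
    using assms
  proof (induction "card V" arbitrary: V a b rule: less_induct)
    case less
    have fin: "finite V" using less.prems by (simp add: gpair_def)
    show ?case
    \<comment> \<open>The empty set is the base case because \<open>S\<close> or \<open>T\<close>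
      may be empty.\<close>
    proof (cases "V = {}")
      case True
      with less.prems have u: "cmod (a {}) = 1" "cmod (b {}) = 1" by (auto simp: gpair_def)
      then have "standard_on [] a b"
        unfolding standard_on_def
        by (intro exI[of _ "\<lambda>_. 1"] exI[of _ "a {}"] exI[of _ "b {} / a {}"])
          (auto simp: norm_divide)
      then show ?thesis using True by (intro exI[of _ "[]"]) auto
    next
      case False
      then obtain m W where m: "V = insert m W" "m \<notin> W" by (meson Set.set_insert ex_in_conv)
      obtain S T d e p q where ST: "S \<union> T = W" "S \<inter> T = {}" and
        S: "gpair S d e" and T: "gpair T p q" and
        ids: "\<And>X. X \<subseteq> W \<Longrightarrow> a X = d (X \<inter> S) * p (X \<inter> T)"
        "\<And>X. X \<subseteq> W \<Longrightarrow> b X = d (X \<inter> S) * q (X \<inter> T)"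
        "\<And>X. X \<subseteq> W \<Longrightarrow> a (insert m X) = - crev S e (X \<inter> S) * crev T q (X \<inter> T)"
        "\<And>X. X \<subseteq> W \<Longrightarrow> b (insert m X) = crev S e (X \<inter> S) * crev T p (X \<inter> T)"
        by (rule gpair_decompose[OF less.prems[unfolded m(1)] m(2)]) (rule that)
      have "card S < card V" "card T < card V"
        by (rule psubset_card_mono[OF fin], use m ST in blast)+
      then obtain lS lT where l: "set lS = S" "distinct lS" "standard_on lS d e"
        "set lT = T" "distinct lT" "standard_on lT p q"
        using less.hyps S T by meson
      have "standard_on (lT @ m # rev lS) a b"
        by (rule standard_on_join[OF l(3,6), of m W]) (use l m ST ids in auto)
      moreover have "set (lT @ m # rev lS) = V" "distinct (lT @ m # rev lS)"
        using l m ST by auto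
      ultimately show ?thesis by blast
    qed
  qed
  then show ?thesis using that by blast
qed

section \<open>Arrays with values in roots of unity\<close>

lemma path_sgn_singleton: "distinct l \<Longrightarrow> path_sgn l {k} = 1"
  by (induction l) (auto simp: hd_sgn_def sgn_at_def)

lemma path_sgn_empty: "path_sgn l {} = 1"
  by (induction l) auto

lemma path_sgn_powi:
  fixes x :: "'i \<Rightarrow> int"
  assumes "\<And>i. i \<in> set l \<Longrightarrow> x i = (if i \<in> X then 1 else 0)"
  shows "path_sgn l X = (-1) powi (\<Sum>i<length l - 1. x (l ! i) * x (l ! Suc i))"
  using assms
proof (induction l)
  case (Cons y l)
  show ?case
  proof (cases l)
    case (Cons z r)
    have "(\<Sum>i<Suc (length r). x ((y # l) ! i) * x ((y # l) ! Suc i))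
        = x y * x z + (\<Sum>i<length r. x (l ! i) * x (l ! Suc i))"
      unfolding sum.lessThan_Suc_shift by (simp add: Cons)
    then have 1: "(\<Sum>i<length (y # l) - 1. x ((y # l) ! i) * x ((y # l) ! Suc i))
        = x y * x z + (\<Sum>i<length l - 1. x (l ! i) * x (l ! Suc i))"
      by (simp add: Cons)
    have 2: "(if y \<in> X then hd_sgn l X else 1) = (-1) powi (x y * x z)"
      using Cons.prems Cons by (auto simp: sgn_at_def)
    have 3: "path_sgn l X = (-1) powi (\<Sum>i<length l - 1. x (l ! i) * x (l ! Suc i))"
      by (rule Cons.IH) (use Cons.prems in auto)
    show ?thesis unfolding 1 path_sgn.simps(2) 2 unfolding 3 by (simp add: power_int_add)
  qed simp
qed simp

lemma power_int_sum:
  fixes z :: "'a :: field"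
  assumes "z \<noteq> 0"
  shows "z powi (\<Sum>k\<in>A. f k) = (\<Prod>k\<in>A. z powi f k)"
  by (induction A rule: infinite_finite_induct) (auto simp: power_int_add assms)

section \<open>Powers of the root of unity\<close>

lemma zeta_powi: "zeta q powi n = cis (2 * pi * n / q)"
proof -
  have "zeta q = cis (2 * pi / q)"
    unfolding zeta_def cis_conv_exp by (simp add: mult_ac)
  then show ?thesis by (simp add: cis_power_int mult_ac)
qed

lemma zeta_nonzero: "zeta q \<noteq> 0"
  by (simp add: zeta_def)

text \<open>Equal powers mean equal angles up to multiples of \<open>2 * pi\<close>. This leads from
  complex values back to congruences modulo \<open>q\<close>.\<close>

lemma zeta_powi_eq_iff:
  assumes "q > 0"
  shows "zeta q powi a = zeta q powi b \<longleftrightarrow> [a = b] (mod q)"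
proof -
  have q: "real_of_int q \<noteq> 0" using assms by simp
  have "zeta q powi a = zeta q powi b
      \<longleftrightarrow> (\<exists>n::int. 2 * pi * a / q = 2 * pi * b / q + 2 * pi * n)"
    unfolding zeta_powi complex_eq_iff using sin_cos_eq_iff[of "2 * pi * a / q" "2 * pi * b / q"] by auto
  also have "\<dots> \<longleftrightarrow> (\<exists>n::int. real_of_int a = real_of_int (b + q * n))"
  proof (rule arg_cong[where f = Ex], rule ext)
    fix n :: int
    have "2 * pi * a / q = 2 * pi * b / q + 2 * pi * n \<longleftrightarrow> 2 * pi * (a / q) = 2 * pi * (b / q + n)"
      by (simp add: distrib_left)
    also have "\<dots> \<longleftrightarrow> a / q = b / q + n" by (simp only: mult_cancel_left) simp
    also have "\<dots> \<longleftrightarrow> real_of_int a = real_of_int (b + q * n)" using q by (simp add: field_simps)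
    finally show "(2 * pi * a / q = 2 * pi * b / q + 2 * pi * n) = (real_of_int a = real_of_int (b + q * n))" .
  qed
  also have "\<dots> \<longleftrightarrow> [a = b] (mod q)"
    by (simp only: of_int_eq_iff) (metis cong_iff_lin cong_sym_eq)
  finally show ?thesis .
qed

lemma zeta_powi_half:
  assumes "q > 0" "even q"
  shows "zeta q powi (q div 2) = - 1"
proof -
  have "real_of_int (q div 2) = q / 2" using assms(2) by auto
  then have "2 * pi * (q div 2) / q = 2 * pi * (q / 2) / q" by (rule arg_cong)
  also have "\<dots> = pi" using assms(1) by simp
  finally have "2 * pi * (q div 2) / q = pi" .
  then show ?thesis unfolding zeta_powi by simp
qed

section \<open>The cube, its subsets and the generating function of the autocorrelations\<close>

lemma finite_cube: "finite (cube m)"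
  unfolding cube_def by (intro finite_PiE) auto

lemma finite_shifts: "finite (shifts m)"
  unfolding shifts_def by (intro finite_PiE) auto

definition ind_vec :: "nat \<Rightarrow> nat set \<Rightarrow> nat \<Rightarrow> int" where
  "ind_vec m X = (\<lambda>k\<in>{1..m}. if k \<in> X then 1 else 0)"

lemma ind_vec_in_cube: "ind_vec m X \<in> cube m"
  by (auto simp: ind_vec_def cube_def)

lemma cubeD: "x \<in> cube m \<Longrightarrow> k \<in> {1..m} \<Longrightarrow> x k = 0 \<or> x k = 1"
  by (auto simp: cube_def PiE_iff)

lemma ind_vec_support: "x \<in> cube m \<Longrightarrow> ind_vec m {k \<in> {1..m}. x k = 1} = x"
  using cubeD[of x m] by (fastforce simp: ind_vec_def cube_def PiE_iff extensional_def fun_eq_iff)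

lemma sum_Pow_cube:
  "(\<Sum>X\<in>Pow {1..m}. F (ind_vec m X) X) = (\<Sum>x\<in>cube m. F x {k \<in> {1..m}. x k = 1})"
proof (rule sum.reindex_bij_witness[where i = "\<lambda>x. {k \<in> {1..m}. x k = 1}" and j = "ind_vec m"])
  fix X assume X: "X \<in> Pow {1..m}"
  then show *: "{k \<in> {1..m}. ind_vec m X k = 1} = X" by (auto simp: ind_vec_def)
  show "ind_vec m X \<in> cube m" by (rule ind_vec_in_cube)
  show "F (ind_vec m X) {k \<in> {1..m}. ind_vec m X k = 1} = F (ind_vec m X) X" unfolding * ..
next
  fix x assume "x \<in> cube m"
  then show "ind_vec m {k \<in> {1..m}. x k = 1} = x" by (rule ind_vec_support)
qed auto

lemma prod_support:
  "(\<Prod>i\<in>{k \<in> {1..m::nat}. P k}. z i) = (\<Prod>k\<in>{1..m}. if P k then z k else (1::complex))"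
  by (rule prod.inter_filter) simp

text \<open>The exponents are raised by one because reversal replaces \<open>-y\<close> by
  \<open>1 - y\<close>; on \<open>shifts m\<close> they are thus natural numbers, and the zero shift
  gives the product of all variables.\<close>

definition shift_monom :: "nat \<Rightarrow> (nat \<Rightarrow> complex) \<Rightarrow> (nat \<Rightarrow> int) \<Rightarrow> complex" where
  "shift_monom m z t = (\<Prod>k\<in>{1..m}. z k ^ nat (t k + 1))"

text \<open>For fixed \<open>y\<close>, the substitution \<open>t = x - y\<close> is a bijection
  between the cube and the shifts that keep \<open>y\<close> in it.\<close>

lemma sum_cube_shifts:
  fixes h :: "(nat \<Rightarrow> int) \<Rightarrow> complex"
  assumes y: "y \<in> cube m"
  shows "(\<Sum>x\<in>cube m. h x * shift_monom m z (\<lambda>k\<in>{1..m}. x k - y k))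
     = (\<Sum>t\<in>shifts m. if add_vec m y t \<in> cube m then h (add_vec m y t) * shift_monom m z t else 0)"
proof -
  have "(\<Sum>t\<in>shifts m. if add_vec m y t \<in> cube m then h (add_vec m y t) * shift_monom m z t else 0)
    = (\<Sum>t\<in>{t \<in> shifts m. add_vec m y t \<in> cube m}. h (add_vec m y t) * shift_monom m z t)"
    by (rule sum.inter_filter[symmetric]) (rule finite_shifts)
  also have "\<dots> = (\<Sum>x\<in>cube m. h x * shift_monom m z (\<lambda>k\<in>{1..m}. x k - y k))"
  proof (rule sum.reindex_bij_witness[where i = "\<lambda>x. \<lambda>k\<in>{1..m}. x k - y k" and j = "add_vec m y"])
    fix t assume t: "t \<in> {t \<in> shifts m. add_vec m y t \<in> cube m}"
    then show *: "(\<lambda>k\<in>{1..m}. add_vec m y t k - y k) = t"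
      by (auto simp: add_vec_def shifts_def PiE_iff extensional_def fun_eq_iff)
    show "add_vec m y t \<in> cube m" using t by simp
    show "h (add_vec m y t) * shift_monom m z (\<lambda>k\<in>{1..m}. add_vec m y t k - y k)
        = h (add_vec m y t) * shift_monom m z t" unfolding * ..
  next
    fix x assume x: "x \<in> cube m"
    then show "add_vec m y (\<lambda>k\<in>{1..m}. x k - y k) = x"
      by (auto simp: add_vec_def cube_def PiE_iff extensional_def fun_eq_iff)
    moreover have "(\<lambda>k\<in>{1..m}. x k - y k) \<in> shifts m"
      unfolding shifts_def using cubeD[OF x] cubeD[OF y] by fastforce
    ultimately show "(\<lambda>k\<in>{1..m}. x k - y k) \<in> {t \<in> shifts m. add_vec m y t \<in> cube m}"
      using x by simp
  qed
  finally show ?thesis ..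
qed

definition array_of :: "int \<Rightarrow> nat \<Rightarrow> ((nat \<Rightarrow> int) \<Rightarrow> int) \<Rightarrow> nat set \<Rightarrow> complex" where
  "array_of q m f X = zeta q powi f (ind_vec m X)"

lemma norm_zeta_powi: "cmod (zeta q powi n) = 1"
  by (simp add: zeta_powi)

text \<open>The reversed factor contributes the monomial of \<open>1 - y\<close> with the conjugate
  of \<open>zeta q powi f y\<close>; the coefficients of the terms with \<open>x - y = t\<close> add
  up to the autocorrelation at \<open>t\<close>.\<close>

lemma mlin_autocorrelation:
  fixes q :: int and m :: nat
  defines "V \<equiv> {1..m}"
  shows "mlin V (array_of q m f) z * mlin V (crev V (array_of q m f)) z
    = (\<Sum>t\<in>shifts m. shift_monom m z t * autocorrelation q m f t)"
proof -
  let ?a = "array_of q m f"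
  have 1: "mlin V ?a z = (\<Sum>x\<in>cube m. zeta q powi f x * (\<Prod>k\<in>V. if x k = 1 then z k else 1))"
    unfolding mlin_def array_of_def V_def
    using sum_Pow_cube[where F = "\<lambda>x X. zeta q powi f x * (\<Prod>i\<in>X. z i)" and m = m]
    unfolding prod_support .
  have "mlin V (crev V ?a) z = (\<Sum>X\<in>Pow V. cnj (?a X) * (\<Prod>i\<in>V - X. z i))"
    unfolding mlin_def
    by (rule sum.reindex_bij_witness[where i = "\<lambda>X. V - X" and j = "\<lambda>X. V - X"])
      (auto simp: crev_def double_diff)
  also have "\<dots> = (\<Sum>y\<in>cube m. cnj (zeta q powi f y) * (\<Prod>k\<in>V. if y k = 1 then 1 else z k))"
  proof -
    have "(\<Prod>i\<in>V - {k \<in> {1..m}. y k = 1}. z i) = (\<Prod>k\<in>V. if y k = 1 then 1 else z k)"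
      for y :: "nat \<Rightarrow> int"
    proof -
      have "V - {k \<in> {1..m}. y k = 1} = {k \<in> {1..m}. y k \<noteq> 1}" by (auto simp: V_def)
      then show ?thesis unfolding V_def by (simp only: prod_support) (rule prod.cong, auto)
    qed
    then show ?thesis
      using sum_Pow_cube[where F = "\<lambda>x X. cnj (zeta q powi f x) * (\<Prod>i\<in>V - X. z i)" and m = m]
      unfolding array_of_def V_def by simp
  qed
  finally have 2: "mlin V (crev V ?a) z
      = (\<Sum>y\<in>cube m. cnj (zeta q powi f y) * (\<Prod>k\<in>V. if y k = 1 then 1 else z k))" .
  have summand: "zeta q powi f x * (\<Prod>k\<in>V. if x k = 1 then z k else 1) *
      (cnj (zeta q powi f y) * (\<Prod>k\<in>V. if y k = 1 then 1 else z k))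
    = zeta q powi (f x - f y) * shift_monom m z (\<lambda>k\<in>{1..m}. x k - y k)"
    if "x \<in> cube m" "y \<in> cube m" for x y
  proof -
    have mon: "(\<Prod>k\<in>V. if x k = 1 then z k else 1) * (\<Prod>k\<in>V. if y k = 1 then 1 else z k)
        = shift_monom m z (\<lambda>k\<in>{1..m}. x k - y k)"
      unfolding shift_monom_def V_def prod.distrib[symmetric]
    proof (rule prod.cong)
      fix k assume k: "k \<in> {1..m}"
      show "(if x k = 1 then z k else 1) * (if y k = 1 then 1 else z k)
          = z k ^ nat ((\<lambda>k\<in>{1..m}. x k - y k) k + 1)"
        using k cubeD[OF that(1) k] cubeD[OF that(2) k] by (auto simp: power2_eq_square)
    qed simp
    have coef: "zeta q powi f x * cnj (zeta q powi f y) = zeta q powi (f x - f y)"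
      by (simp add: zeta_powi cis_cnj cis_mult diff_divide_distrib right_diff_distrib)
    show ?thesis unfolding mon[symmetric] coef[symmetric] by (simp only: mult_ac)
  qed
  have "mlin V ?a z * mlin V (crev V ?a) z
      = (\<Sum>x\<in>cube m. \<Sum>y\<in>cube m. zeta q powi (f x - f y) * shift_monom m z (\<lambda>k\<in>{1..m}. x k - y k))"
    unfolding 1 2 sum_product by (intro sum.cong refl summand)
  also have "\<dots> = (\<Sum>y\<in>cube m. \<Sum>x\<in>cube m. zeta q powi (f x - f y) * shift_monom m z (\<lambda>k\<in>{1..m}. x k - y k))"
    by (rule sum.swap)
  also have "\<dots> = (\<Sum>y\<in>cube m. \<Sum>t\<in>shifts m. if add_vec m y t \<in> cube m
      then zeta q powi (f (add_vec m y t) - f y) * shift_monom m z t else 0)"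
    by (intro sum.cong refl sum_cube_shifts)
  also have "\<dots> = (\<Sum>t\<in>shifts m. \<Sum>y\<in>cube m. if add_vec m y t \<in> cube m
      then zeta q powi (f (add_vec m y t) - f y) * shift_monom m z t else 0)"
    by (rule sum.swap)
  also have "\<dots> = (\<Sum>t\<in>shifts m. shift_monom m z t * autocorrelation q m f t)"
    unfolding autocorrelation_def sum_distrib_left by (intro sum.cong refl) simp
  finally show ?thesis .
qed

lemma autocorrelation_zero: "autocorrelation q m f (zero_vec m) = of_nat (card (cube m))"
proof -
  have "add_vec m x (zero_vec m) = x" if "x \<in> cube m" for x
    using that by (auto simp: add_vec_def zero_vec_def cube_def PiE_iff extensional_def fun_eq_iff)
  then show ?thesis by (simp add: autocorrelation_def)
qed

lemma golay_gpair:
  assumes "golay_array_pair q m f g"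
  shows "gpair {1..m} (array_of q m f) (array_of q m g)"
proof -
  let ?V = "{1..m}" and ?a = "array_of q m f" and ?b = "array_of q m g"
  \<comment> \<open>Only the zero shift survives, and there each of the two arrays contributes 1 for
    every point of the cube.\<close>
  let ?c = "of_nat (2 * card (cube m)) :: complex"
  have z: "zero_vec m \<in> shifts m" by (auto simp: zero_vec_def shifts_def)
  have eq: "mlin ?V ?a z * mlin ?V (crev ?V ?a) z + mlin ?V ?b z * mlin ?V (crev ?V ?b) z
        = ?c * (\<Prod>i\<in>?V. z i)" for z
  proof -
    have "mlin ?V ?a z * mlin ?V (crev ?V ?a) z + mlin ?V ?b z * mlin ?V (crev ?V ?b) z
        = (\<Sum>t\<in>shifts m. shift_monom m z t * (autocorrelation q m f t + autocorrelation q m g t))"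
      unfolding mlin_autocorrelation by (simp add: sum.distrib distrib_left)
    also have "\<dots> = (\<Sum>t\<in>{zero_vec m}. shift_monom m z t * (autocorrelation q m f t + autocorrelation q m g t))"
      by (rule sum.mono_neutral_right)
        (use assms z finite_shifts in \<open>auto simp: golay_array_pair_def\<close>)
    also have "\<dots> = shift_monom m z (zero_vec m) * ?c" by (simp add: autocorrelation_zero)
    also have "shift_monom m z (zero_vec m) = (\<Prod>i\<in>?V. z i)"
      unfolding shift_monom_def by (rule prod.cong) (auto simp: zero_vec_def)
    finally show ?thesis by (simp add: mult.commute)
  qed
  have nz: "?c \<noteq> 0"
  proof -
    have "cube m \<noteq> {}" using ind_vec_in_cube by blast
    then show ?thesis using finite_cube[of m] by simp
  qed
  show ?thesis
    unfolding gpair_def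
    by (intro conjI exI[of _ ?c] allI impI eq nz) (auto simp: array_of_def norm_zeta_powi)
qed

lemma nth_permutes:
  assumes "set l = {1..m}" "distinct l"
  shows "(\<lambda>k. if k \<in> {1..m} then l ! (k - 1) else k) permutes {1..m}"
proof (rule bij_imp_permutes)
  have len: "length l = m" using distinct_card[OF assms(2)] assms(1) by simp
  \<comment> \<open>Variables are numbered from 1, list positions from 0.\<close>
  have "bij_betw (\<lambda>k. k - 1) {1..m} {..<m}"
    by (rule bij_betw_byWitness[where f' = Suc]) auto
  moreover have "bij_betw ((!) l) {..<m} {1..m}"
    using bij_betw_nth[OF assms(2)] len assms(1) by blast
  ultimately have "bij_betw ((!) l \<circ> (\<lambda>k. k - 1)) {1..m} {1..m}" by (rule bij_betw_trans)
  then show "bij_betw (\<lambda>k. if k \<in> {1..m} then l ! (k - 1) else k) {1..m} {1..m}"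
    by (rule bij_betw_cong[THEN iffD1, rotated]) auto
qed auto

theorem theorem1:
  fixes q :: int and m :: nat and f g :: "(nat \<Rightarrow> int) \<Rightarrow> int"
  assumes "q \<ge> 2" and "even q" and "m \<ge> 1"
    and "qary_array q m f" and "qary_array q m g"
    and "golay_array_pair q m f g"
  shows "standard_pair q m f g"
proof -
  let ?z = "zeta q"
  let ?a = "array_of q m f" and ?b = "array_of q m g"
  obtain l where l: "set l = {1..m}" "distinct l" "standard_on l ?a ?b"
    by (rule gpair_standard[OF golay_gpair[OF assms(6)]]) (rule that)
  have len: "length l = m" using distinct_card[OF l(2)] l(1) by simp
  from l(3) obtain u v \<chi> where std: "cmod u = 1" "cmod v = 1" "\<And>i. cmod (\<chi> i) = 1"
    "\<And>X. X \<subseteq> set l \<Longrightarrow> ?a X = u * (\<Prod>i\<in>X. \<chi> i) * path_sgn l X"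
    "\<And>X. X \<subseteq> set l \<Longrightarrow> ?b X = v * ?a X * hd_sgn l X"
    by (rule standard_onE) (rule that)
  have q: "q > 0" using assms(1) by simp
  define p where "p k = (if k \<in> {1..m} then l ! (k - 1) else k)" for k
  \<comment> \<open>The path sign is 1 on the empty set and on singletons, so the values of
    \<open>f\<close> at the origin and at the unit vectors determine the constant and linear
    coefficients.\<close>
  define f0 g0 where "f0 = f (ind_vec m {})" and "g0 = g (ind_vec m {})"
  define c where "c k = (f (ind_vec m {k}) - f0) mod q" for k
  define c' where "c' = (g0 - f0) mod q"
  have powi_mod: "?z powi (n mod q) = ?z powi n" for n
    using zeta_powi_eq_iff[OF q] by (simp add: cong_def)
  have u: "u = ?z powi f0"
    using std(4)[of "{}"] by (simp add: array_of_def f0_def path_sgn_empty)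
  have chi: "\<chi> k = ?z powi c k" if "k \<in> {1..m}" for k
  proof -
    have "?a {k} = u * \<chi> k" using std(4)[of "{k}"] that l by (simp add: path_sgn_singleton)
    then have "?z powi f (ind_vec m {k}) = ?z powi f0 * \<chi> k" by (simp add: u array_of_def)
    then show ?thesis
      unfolding c_def powi_mod by (simp add: power_int_diff zeta_nonzero)
  qed
  have v: "v = ?z powi c'"
  proof -
    have "?z powi g0 = v * ?z powi f0"
      using std(5)[of "{}"] by (auto simp: array_of_def f0_def g0_def hd_sgn_def sgn_at_def)
    then show ?thesis
      unfolding c'_def powi_mod by (simp add: power_int_diff zeta_nonzero)
  qed
  \<comment> \<open>For even \<open>q\<close>, signs become multiples of \<open>q div 2\<close> in
    the exponent.\<close>
  have half: "?z powi (q div 2 * n) = (- 1) powi n" for n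
    by (simp add: power_int_mult zeta_powi_half[OF q assms(2)])
  have main: "cong (f x) ((q div 2) * (\<Sum>k = 1..m - 1. x (p k) * x (p (k + 1)))
                  + (\<Sum>k = 1..m. c k * x k) + f0) q"
    "cong (g x) (f x + (q div 2) * x (p 1) + c') q" if x: "x \<in> cube m" for x
  proof -
    let ?X = "{k \<in> {1..m}. x k = 1}"
    have X: "?X \<subseteq> set l" unfolding l(1) by blast
    have aX: "?a ?X = ?z powi f x" "?b ?X = ?z powi g x"
      by (simp_all only: array_of_def ind_vec_support[OF x])
    have xl: "x i = (if i \<in> ?X then 1 else 0)" if "i \<in> set l" for i
      using cubeD[OF x, of i] that l(1) by auto
    have "path_sgn l ?X = (-1) powi (\<Sum>i<m - 1. x (l ! i) * x (l ! Suc i))"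
      using path_sgn_powi[of l x ?X] xl len by blast
    also have "(\<Sum>i<m - 1. x (l ! i) * x (l ! Suc i)) = (\<Sum>k = 1..m - 1. x (p k) * x (p (k + 1)))"
      unfolding One_nat_def sum.atLeast1_atMost_eq
    proof (rule sum.cong)
      fix k assume "k \<in> {..<m - Suc 0}"
      then have "Suc k < m" by auto
      then have "p (Suc k) = l ! k" "p (Suc k + Suc 0) = l ! Suc k" by (simp_all add: p_def)
      then show "x (l ! k) * x (l ! Suc k) = x (p (Suc k)) * x (p (Suc k + Suc 0))" by simp
    qed simp
    finally have ps: "path_sgn l ?X = ?z powi (q div 2 * (\<Sum>k = 1..m - 1. x (p k) * x (p (k + 1))))"
      by (simp only: half)
    have "(\<Prod>i\<in>?X. \<chi> i) = (\<Prod>k\<in>{1..m}. if x k = 1 then \<chi> k else 1)" by (rule prod_support)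
    also have "\<dots> = (\<Prod>k\<in>{1..m}. ?z powi (c k * x k))"
    proof (rule prod.cong)
      fix k assume k: "k \<in> {1..m}"
      show "(if x k = 1 then \<chi> k else 1) = ?z powi (c k * x k)"
        using cubeD[OF x k] chi[OF k] by auto
    qed simp
    finally have lin: "(\<Prod>i\<in>?X. \<chi> i) = ?z powi (\<Sum>k = 1..m. c k * x k)"
      by (simp add: power_int_sum zeta_nonzero)
    have "?z powi f x = ?z powi ((q div 2) * (\<Sum>k = 1..m - 1. x (p k) * x (p (k + 1)))
                  + (\<Sum>k = 1..m. c k * x k) + f0)"
      using std(4)[OF X] unfolding aX ps lin u by (simp add: power_int_add zeta_nonzero mult_ac)
    then show "cong (f x) ((q div 2) * (\<Sum>k = 1..m - 1. x (p k) * x (p (k + 1)))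
                  + (\<Sum>k = 1..m. c k * x k) + f0) q"
      using zeta_powi_eq_iff[OF q] by blast
    \<comment> \<open>As \<open>m \<ge> 1\<close>, the path has a head, and the head sign is the
      term in \<open>x (p 1)\<close>.\<close>
    have "l \<noteq> []" using len assms(3) by auto
    then have p1: "p 1 = hd l" "l \<noteq> []" "hd l \<in> set l" using assms(3) by (auto simp: p_def hd_conv_nth)
    have "hd_sgn l ?X = ?z powi (q div 2 * x (p 1))"
      using xl[OF p1(3)] p1 unfolding half by (auto simp: hd_sgn_def sgn_at_def)
    then have "?z powi g x = ?z powi (f x + (q div 2) * x (p 1) + c')"
      using std(5)[OF X] unfolding aX v by (simp add: power_int_add zeta_nonzero mult_ac)
    then show "cong (g x) (f x + (q div 2) * x (p 1) + c') q"
      using zeta_powi_eq_iff[OF q] by blast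
  qed
  have "p permutes {1..m}" using nth_permutes[OF l(1,2)] unfolding p_def .
  moreover have "f0 \<in> residues_mod q"
    using assms(4) ind_vec_in_cube by (auto simp: qary_array_def f0_def)
  moreover have "\<forall>k\<in>{1..m}. c k \<in> residues_mod q" "c' \<in> residues_mod q"
    using q by (auto simp: residues_mod_def c_def c'_def)
  ultimately show ?thesis
    unfolding standard_pair_def using main by blast
qed

end
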